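(* Let $I \subseteq \overline{\mathbb R}[x_1,\dots,x_n]$ be a tropical ideal. Then the variety $V(I) \subseteq \overline{\mathbb R}^{n}$ is (the support of) a finite polyhedral complex in $\overline{\mathbb R}^{n}$.
   Context: $\overline{\mathbb R} = (\mathbb R\cup\{\infty\},\oplus,\odot)$ is the tropical semiring with $\oplus=\min$, $\odot=+$. $\overline{\mathbb R}[x_1,\dots,x_n]$ is the semiring of (formal) polynomials with coefficients in $\overline{\mathbb R}$, with tropical operations; polynomials are not identified with functions. $[f]_{\mathbf x^{\mathbf u}}$ denotes the coefficient of $\mathbf x^{\mathbf u}$ in $f$ (equal to $\infty$ if the monomial does not occur). An ideal of a semiring is a nonempty subset closed under addition and under multiplication by arbitrary elements of the semiring. For an ideal $I$, $I_{\le d}$ is the set of polynomials in $I$ of degree at most $d$. Tropical ideal: an ideal $I\subseteq\overline{\mathbb R}[x_1,\dots,x_n]$ such that for every $d\ge 0$, any $f,g\in I_{\le d}$ and any monomial $\mathbf x^{\mathbf u}$ with $[f]_{\mathbf x^{\mathbf u}}=[g]_{\mathbf x^{\mathbf u}}\ne\infty$, there is $h\in I_{\le d}$ with $[h]_{\mathbf x^{\mathbf u}}=\infty$ and $[h]_{\mathbf x^{\mathbf v}}\ge\min([f]_{\mathbf x^{\mathbf v}},[g]_{\mathbf x^{\mathbf v}})$ for all monomials $\mathbf x^{\mathbf v}$, with equality whenever $[f]_{\mathbf x^{\mathbf v}}\ne[g]_{\mathbf x^{\mathbf v}}$. (Equivalently, each $I_{\le d}$ is the set of vectors of a valuated matroid.)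 Varieties: for a polynomial $f$, $V(f)=\{\mathbf w\in\overline{\mathbb R}^n : f(\mathbf w)=\infty$ or the minimum in $f(\mathbf w)$ is achieved at least twice (i.e. by at least two terms)$\}$, and $V(I)=\bigcap_{f\in I}V(f)$. Polyhedral complexes in $\overline{\mathbb R}^n$: for $\sigma\subseteq\{1,\dots,n\}$ let $\overline{\mathbb R}^n_\sigma=\{\mathbf w\in\overline{\mathbb R}^n: w_i=\infty \text{ for } i\in\sigma,\ w_i\neq\infty\text{ for } i\notin\sigma\}\cong\mathbb R^{n-|\sigma|}$. The topology on $\overline{\mathbb R}$ has as basis the open intervals of $\mathbb R$ and the sets $(a,\infty]$; $\overline{\mathbb R}^n$ has the product topology. A polyhedral complex $\Delta$ in $\overline{\mathbb R}^n$ is a collection of polyhedral complexes $\Delta_\sigma\subseteq\overline{\mathbb R}^n_\sigma$, one for each $\sigma\subseteq\{1,\dots,n\}$, such that if $\tau\subseteq\sigma$ and $P\in\Delta_\tau$, then the closure of $P$ in $\overline{\mathbb R}^n$ intersected with $\overline{\mathbb R}^n_\sigma$ is contained in a polyhedron of $\Delta_\sigma$. It is finite if every $\Delta_\sigma$ is finite; its support is the union of all its polyhedra. *)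

theory Defs
  imports "HOL-Analysis.Analysis" "HOL-Library.Poly_Mapping"
begin

datatype trop = Fin real | Infty

instantiation trop :: linorder
begin

fun less_eq_trop :: "trop \<Rightarrow> trop \<Rightarrow> bool" where
  "Fin a \<le> Fin b \<longleftrightarrow> a \<le> b"
| "x \<le> Infty \<longleftrightarrow> True"
| "Infty \<le> Fin b \<longleftrightarrow> False"

definition less_trop :: "trop \<Rightarrow> trop \<Rightarrow> bool" where
  "less_trop x y \<longleftrightarrow> x \<le> y \<and> \<not> y \<le> x"

instance
proof
  fix x y z :: trop
  show "x < y \<longleftrightarrow> x \<le> y \<and> \<not> y \<le> x"
    by (rule less_trop_def)
  show "x \<le> x"
    by (cases x) auto
  show "x \<le> z" if "x \<le> y" "y \<le> z"
    using that by (cases x; cases y; cases z) auto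
  show "x = y" if "x \<le> y" "y \<le> x"
    using that by (cases x; cases y) auto
  show "x \<le> y \<or> y \<le> x"
    by (cases x; cases y) auto
qed

end

text \<open>
  The semiring operations of the type class are the tropical ones, so \<open>0 = Infty\<close> and
  \<open>1 = Fin 0\<close>; sums, products and powers over \<^typ>\<open>trop\<close> are to be read tropically.
\<close>

instantiation trop :: comm_semiring_1
begin

definition zero_trop :: trop where
  "0 = Infty"

definition one_trop :: trop where
  "1 = Fin 0"

definition plus_trop :: "trop \<Rightarrow> trop \<Rightarrow> trop" where
  "plus_trop x y = min x y"

fun times_trop :: "trop \<Rightarrow> trop \<Rightarrow> trop" where
  "Fin a * Fin b = Fin (a + b)"
| "Infty * y = Infty"
| "Fin a * Infty = Infty"

instance
proof
  fix x y z :: trop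
  show "x + y + z = x + (y + z)" "x + y = y + x"
    by (simp_all add: plus_trop_def ac_simps)
  show "0 + x = x"
    by (cases x) (simp_all add: plus_trop_def zero_trop_def min_def)
  show "x * y * z = x * (y * z)"
    by (cases x; cases y; cases z) simp_all
  show "x * y = y * x"
    by (cases x; cases y) simp_all
  show "1 * x = x"
    by (cases x) (simp_all add: one_trop_def)
  show "0 * x = 0" "x * 0 = 0"
    by (cases x; simp add: zero_trop_def)+
  show "(x + y) * z = x * z + y * z"
    by (cases x; cases y; cases z) (simp_all add: plus_trop_def min_def)
  show "(0::trop) \<noteq> 1"
    by (simp add: zero_trop_def one_trop_def)
qed

end

text \<open>
  The generating sets below are closed under intersection and cover \<^typ>\<open>trop\<close>, so they form a
  basis of the generated topology.  The space \<open>trop ^ 'n\<close> carries the library's product topology.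
\<close>

instantiation trop :: topological_space
begin

definition open_trop :: "trop set \<Rightarrow> bool" where
  "open_trop =
     generate_topology ({Fin ` {a<..<b} | a b. True} \<union> {insert Infty (Fin ` {a<..}) | a. True})"

instance
proof
  show "open (UNIV :: trop set)"
    unfolding open_trop_def by (rule generate_topology.UNIV)
  show "open (S \<inter> T)" if "open S" "open T" for S T :: "trop set"
    using that unfolding open_trop_def by (rule generate_topology.Int)
  show "open (\<Union>K)" if "\<forall>S\<in>K. open S" for K :: "trop set set"
    using that unfolding open_trop_def by (intro generate_topology.UN) auto
qed

end

text \<open>
  Formal polynomials in variables indexed by the finite type \<open>'n\<close>: finitely supported functions
  from exponent vectors to coefficients, with the convolution product.  ``Finitely supported''
  means \<open>0 = Infty\<close> off a finite set, so \<^const>\<open>Poly_Mapping.keys\<close> is the set of monomials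
  that occur.
\<close>

type_synonym 'n trop_poly = "('n \<Rightarrow>\<^sub>0 nat) \<Rightarrow>\<^sub>0 trop"

definition semiring_ideal :: "'a::comm_semiring_1 set \<Rightarrow> bool" where
  "semiring_ideal I \<longleftrightarrow>
     I \<noteq> {} \<and> (\<forall>f\<in>I. \<forall>g\<in>I. f + g \<in> I) \<and> (\<forall>f\<in>I. \<forall>h. h * f \<in> I)"

definition monomial_degree :: "('n::finite \<Rightarrow>\<^sub>0 nat) \<Rightarrow> nat" where
  "monomial_degree u = (\<Sum>i\<in>UNIV. Poly_Mapping.lookup u i)"

definition degree_le_part :: "'n::finite trop_poly set \<Rightarrow> nat \<Rightarrow> 'n trop_poly set" where
  "degree_le_part I d = {f \<in> I. \<forall>u\<in>Poly_Mapping.keys f. monomial_degree u \<le> d}"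

definition tropical_ideal :: "'n::finite trop_poly set \<Rightarrow> bool" where
  "tropical_ideal I \<longleftrightarrow>
     semiring_ideal I \<and>
     (\<forall>d. \<forall>f\<in>degree_le_part I d. \<forall>g\<in>degree_le_part I d. \<forall>u.
        Poly_Mapping.lookup f u = Poly_Mapping.lookup g u \<and> Poly_Mapping.lookup f u \<noteq> Infty \<longrightarrow>
        (\<exists>h\<in>degree_le_part I d.
           Poly_Mapping.lookup h u = Infty \<and>
           (\<forall>v. Poly_Mapping.lookup h v \<ge> min (Poly_Mapping.lookup f v) (Poly_Mapping.lookup g v) \<and>
                (Poly_Mapping.lookup f v \<noteq> Poly_Mapping.lookup g v \<longrightarrow>
                 Poly_Mapping.lookup h v =
                   min (Poly_Mapping.lookup f v) (Poly_Mapping.lookup g v)))))"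

definition term_value :: "'n::finite trop_poly \<Rightarrow> ('n \<Rightarrow>\<^sub>0 nat) \<Rightarrow> trop ^ 'n \<Rightarrow> trop" where
  "term_value f u w = Poly_Mapping.lookup f u * (\<Prod>i\<in>UNIV. w $ i ^ Poly_Mapping.lookup u i)"

definition poly_value :: "'n::finite trop_poly \<Rightarrow> trop ^ 'n \<Rightarrow> trop" where
  "poly_value f w = (\<Sum>u\<in>Poly_Mapping.keys f. term_value f u w)"

definition variety :: "'n::finite trop_poly \<Rightarrow> (trop ^ 'n) set" where
  "variety f =
     {w. poly_value f w = Infty \<or>
         (\<exists>u\<in>Poly_Mapping.keys f. \<exists>v\<in>Poly_Mapping.keys f.
            u \<noteq> v \<and> term_value f u w = poly_value f w \<and> term_value f v w = poly_value f w)}"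

definition ideal_variety :: "'n::finite trop_poly set \<Rightarrow> (trop ^ 'n) set" where
  "ideal_variety I = (\<Inter>f\<in>I. variety f)"

text \<open>
  As in the library's \<^const>\<open>simplicial_complex\<close>, the empty set counts as a polyhedron and as a face
  of every polyhedron.  Finiteness is not part of the definition.
\<close>

definition polyhedral_complex :: "'a::euclidean_space set set \<Rightarrow> bool" where
  "polyhedral_complex C \<longleftrightarrow>
     (\<forall>P\<in>C. polyhedron P) \<and>
     (\<forall>P\<in>C. \<forall>F. F face_of P \<longrightarrow> F \<in> C) \<and>
     (\<forall>P\<in>C. \<forall>Q\<in>C. (P \<inter> Q) face_of P \<and> (P \<inter> Q) face_of Q)"

definition stratum :: "'n::finite set \<Rightarrow> (trop ^ 'n) set" where
  "stratum \<sigma> = {w. \<forall>i. w $ i = Infty \<longleftrightarrow> i \<in> \<sigma>}"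

fun real_part :: "trop \<Rightarrow> real" where
  "real_part (Fin a) = a"
| "real_part Infty = 0"

text \<open>
  On \<open>stratum \<sigma>\<close> the map \<open>chart\<close> is a bijection onto the coordinate subspace of \<open>real ^ 'n\<close> whose
  coordinates in \<open>\<sigma>\<close> vanish; this subspace is the model of the Euclidean space of dimension
  \<open>n - card \<sigma>\<close>.  Polyhedra and faces do not depend on whether they are formed in the
  subspace or in the ambient space.
\<close>

definition chart :: "trop ^ 'n::finite \<Rightarrow> real ^ 'n" where
  "chart w = (\<chi> i. real_part (w $ i))"

definition stratum_complex :: "'n::finite set \<Rightarrow> (trop ^ 'n) set set \<Rightarrow> bool" where
  "stratum_complex \<sigma> C \<longleftrightarrow> (\<forall>P\<in>C. P \<subseteq> stratum \<sigma>) \<and> polyhedral_complex ((\<lambda>P. chart ` P) ` C)"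

definition trop_polyhedral_complex :: "('n::finite set \<Rightarrow> (trop ^ 'n) set set) \<Rightarrow> bool" where
  "trop_polyhedral_complex \<Delta> \<longleftrightarrow>
     (\<forall>\<sigma>. stratum_complex \<sigma> (\<Delta> \<sigma>)) \<and>
     (\<forall>\<tau> \<sigma>. \<tau> \<subseteq> \<sigma> \<longrightarrow> (\<forall>P\<in>\<Delta> \<tau>. \<exists>Q\<in>\<Delta> \<sigma>. closure P \<inter> stratum \<sigma> \<subseteq> Q))"

definition finite_complex :: "('n::finite set \<Rightarrow> (trop ^ 'n) set set) \<Rightarrow> bool" where
  "finite_complex \<Delta> \<longleftrightarrow> (\<forall>\<sigma>. finite (\<Delta> \<sigma>))"

definition complex_support :: "('n::finite set \<Rightarrow> (trop ^ 'n) set set) \<Rightarrow> (trop ^ 'n) set" where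
  "complex_support \<Delta> = (\<Union>\<sigma>. \<Union>(\<Delta> \<sigma>))"

end

theory Submission
  imports Defs
begin

text \<open>
  Fix a stratum \<open>\<sigma>\<close>, delete all terms involving variables in \<open>\<sigma>\<close>, and let \<open>L d\<close> be the set of
  coefficient functions obtained from \<open>I\<close> in degree \<open>\<le> d\<close>.  A weight \<open>w\<close>, with ties broken by a
  fixed additive injection \<open>\<kappa>\<close> of the monomials into the reals, assigns to \<open>L d\<close> a set of initial
  monomials.  By elimination the complement of this set is a basis of a matroid that does not
  depend on \<open>w\<close>, so the Hilbert function of the initial monomial ideal is constant, and compactness
  together with Dickson's lemma leaves only finitely many initial ideals \<open>M\<close>.

  The weights at which every \<open>u \<in> M\<close> is minimal in its fundamental vector (the essentially unique
  vector whose only monomial in \<open>M\<close> is \<open>u\<close>) form a polyhedron, since generators of \<open>M\<close> suffice.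
  On this polyhedron, \<open>w\<close> lies in the variety iff each of these minima is attained twice, which
  cuts out a union of faces.  Hence \<open>V(I)\<close> meets every stratum in a finite union of polyhedra.
  Subdividing all strata by one common finite hyperplane arrangement gives the complex; the closure
  condition holds because \<open>V(I)\<close> is closed and the part of the closure of a cell in a smaller
  stratum is convex and on one side of every hyperplane used there.
\<close>

section \<open>Initial monomials of valuated matroids\<close>

text \<open>The variety is cut out by infinitely many conditions, one for each polynomial;
  finiteness has to come from the initial sets. A weight alone leaves ties, so that an initial form
  can have several terms. Breaking them by \<kappa> acts like the weight
  \<open>w + \<epsilon> \<kappa>\<close> with infinitesimal \<epsilon>: injectivity of \<kappa>
  singles out one monomial, and additivity makes the choice compatible with multiplication by
  monomials. Since \<open>I\<close> need not be homogeneous, elimination is available only below a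
  degree bound \<open>d\<close>, and the bound becomes part of the data: a pair
  \<open>(d, u)\<close> stands for the monomial \<open>u\<close> homogenized to degree
  \<open>d\<close>. Counting replaces division: an inclusion between two initial sets is already an
  equality, because both have the same finite number of elements in every degree. This turns
  inequalities for generators of \<open>M\<close> into inequalities for all of \<open>M\<close>. A
  weight in the cell of \<open>M\<close> can have another initial set; moving from it towards a
  weight that defines \<open>M\<close> restores \<open>M\<close> at once, so statements about such a
  point are obtained as limits.\<close>

lemma trop_less_simps [simp]:
  "Fin a < Fin b \<longleftrightarrow> a < b" "Fin a < Infty" "\<not> Infty < x"
  by (cases x; auto simp: less_trop_def)+

lemma trop_le_Infty_iff [simp]: "Infty \<le> x \<longleftrightarrow> x = Infty" "x \<le> Infty"
  by (cases x; simp)+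

lemma trop_times_Infty [simp]: "x * Infty = Infty"
  by (cases x) auto

lemma trop_times_eq_Infty_iff [simp]: "x * y = Infty \<longleftrightarrow> x = Infty \<or> y = Infty"
  by (cases x; cases y) auto

lemma trop_neq_Infty_iff: "x \<noteq> Infty \<longleftrightarrow> x = Fin (real_part x)"
  by (cases x) auto

text \<open>\<open>real_part\<close> sends \<open>Infty\<close> to 0, so this number is the value of
  a term of \<open>f\<close> only when \<open>f u \<noteq> Infty\<close>.\<close>

definition tval :: "('e \<Rightarrow> real) \<Rightarrow> ('e \<Rightarrow> trop) \<Rightarrow> 'e \<Rightarrow> real" where
  "tval \<phi> f u = real_part (f u) + \<phi> u"

text \<open>Comparison of term values under the weight \<open>\<phi> + \<epsilon> * \<kappa>\<close>
  with infinitesimal \<epsilon> > 0.\<close>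

definition precedes :: "('e \<Rightarrow> real) \<Rightarrow> ('e \<Rightarrow> real) \<Rightarrow> ('e \<Rightarrow> trop) \<Rightarrow> 'e \<Rightarrow> 'e \<Rightarrow> bool" where
  "precedes \<kappa> \<phi> f u v \<longleftrightarrow>
     tval \<phi> f u < tval \<phi> f v \<or> (tval \<phi> f u = tval \<phi> f v \<and> \<kappa> u < \<kappa> v)"

definition is_init :: "('e \<Rightarrow> real) \<Rightarrow> ('e \<Rightarrow> real) \<Rightarrow> ('e \<Rightarrow> trop) \<Rightarrow> 'e \<Rightarrow> bool" where
  "is_init \<kappa> \<phi> f u \<longleftrightarrow> f u \<noteq> Infty \<and> (\<forall>v. v \<noteq> u \<longrightarrow> f v \<noteq> Infty \<longrightarrow> precedes \<kappa> \<phi> f u v)"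

definition initials :: "('e \<Rightarrow> real) \<Rightarrow> ('e \<Rightarrow> real) \<Rightarrow> ('e \<Rightarrow> trop) set \<Rightarrow> 'e set" where
  "initials \<kappa> \<phi> L = {u. \<exists>f\<in>L. is_init \<kappa> \<phi> f u}"

text \<open>The vectors of a valuated matroid on \<open>E\<close>, seen through scaling and
  elimination; scaling brings any two vectors with a common support element into the position that
  \<open>elim\<close> asks for.\<close>

locale valuated_vectors =
  fixes E :: "'e set" and L :: "('e \<Rightarrow> trop) set" and \<kappa> :: "'e \<Rightarrow> real"
  assumes finite_ground: "finite E"
    and support: "\<And>f u. f \<in> L \<Longrightarrow> f u \<noteq> Infty \<Longrightarrow> u \<in> E"
    and scale: "\<And>f c. f \<in> L \<Longrightarrow> (\<lambda>u. Fin c * f u) \<in> L"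
    and elim: "\<And>f g u. f \<in> L \<Longrightarrow> g \<in> L \<Longrightarrow> f u = g u \<Longrightarrow> f u \<noteq> Infty \<Longrightarrow>
      \<exists>h\<in>L. h u = Infty \<and> (\<forall>v. min (f v) (g v) \<le> h v \<and> (f v \<noteq> g v \<longrightarrow> h v = min (f v) (g v)))"
    and inj_tiebreak: "inj_on \<kappa> E"
begin

text \<open>Vectors are read as linear relations among the elements of \<open>E\<close>: a set is
  independent if it carries only the trivial relation, and spanning if every other element is tied
  to it by a relation.\<close>

definition independent :: "'e set \<Rightarrow> bool" where
  "independent A \<longleftrightarrow> (\<forall>f\<in>L. (\<forall>v. f v \<noteq> Infty \<longrightarrow> v \<in> A) \<longrightarrow> (\<forall>v. f v = Infty))"

definition spanning :: "'e set \<Rightarrow> bool" where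
  "spanning B \<longleftrightarrow> (\<forall>u\<in>E - B. \<exists>f\<in>L. f u \<noteq> Infty \<and> (\<forall>v. f v \<noteq> Infty \<longrightarrow> v \<in> insert u B))"

lemma rescale:
  assumes "g \<in> L" "g u \<noteq> Infty" "a \<noteq> Infty"
  obtains c where "(\<lambda>v. Fin c * g v) \<in> L" "Fin c * g u = a"
proof -
  obtain x y where "g u = Fin x" "a = Fin y"
    using assms by (cases "g u"; cases a) auto
  then show ?thesis
    using that[of "y - x"] scale[OF assms(1)] by simp
qed

lemma elim_support:
  assumes "f \<in> L" "g \<in> L" "f u \<noteq> Infty" "g u \<noteq> Infty"
  obtains h where "h \<in> L" "h u = Infty"
    "\<And>v. h v \<noteq> Infty \<Longrightarrow> f v \<noteq> Infty \<or> g v \<noteq> Infty"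
    "\<And>v. f v \<noteq> Infty \<Longrightarrow> g v = Infty \<Longrightarrow> h v \<noteq> Infty"
proof -
  obtain c where c: "(\<lambda>v. Fin c * g v) \<in> L" "Fin c * g u = f u"
    using rescale[OF assms(2,4,3)] by blast
  obtain h where h: "h \<in> L" "h u = Infty"
    "\<forall>v. min (f v) (Fin c * g v) \<le> h v \<and> (f v \<noteq> Fin c * g v \<longrightarrow> h v = min (f v) (Fin c * g v))"
    using elim[OF assms(1) c(1) c(2)[symmetric] assms(3)] by auto
  show ?thesis
  proof (rule that[OF h(1,2)])
    fix v
    show "f v \<noteq> Infty \<or> g v \<noteq> Infty" if "h v \<noteq> Infty"
      using h(3)[rule_format, of v] that by (auto simp: min_def split: if_splits)
    show "h v \<noteq> Infty" if "f v \<noteq> Infty" "g v = Infty"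
      using h(3)[rule_format, of v] that by (auto simp: min_def split: if_splits)
  qed
qed

text \<open>Steinitz exchange: some \<open>u\<close> in \<open>A - B\<close> satisfies a relation
  with \<open>B\<close>, and independence of \<open>A\<close> puts an element \<open>v\<close>
  outside \<open>A\<close> into that relation. Replacing \<open>v\<close> by \<open>u\<close> keeps
  \<open>B\<close> spanning and lowers \<open>card (A - B)\<close>.\<close>

lemma independent_card_le_spanning:
  assumes "independent A" "A \<subseteq> E" "spanning B" "B \<subseteq> E"
  shows "card A \<le> card B"
  using assms(3,4)
proof (induction "card (A - B)" arbitrary: B rule: less_induct)
  case less
  have fin: "finite A" "finite B"
    using finite_ground assms(2) less.prems(2) finite_subset by auto
  show ?case
  proof (cases "A \<subseteq> B")
    case True
    then show ?thesis using fin by (simp add: card_mono)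
  next
    case False
    then obtain u where u: "u \<in> A" "u \<notin> B" by auto
    then obtain f where f: "f \<in> L" "f u \<noteq> Infty" "\<And>v. f v \<noteq> Infty \<Longrightarrow> v \<in> insert u B"
      using less.prems(1) assms(2) unfolding spanning_def by blast
    then obtain v where v: "f v \<noteq> Infty" "v \<notin> A"
      using assms(1) unfolding independent_def by blast
    then have vB: "v \<in> B" "v \<noteq> u" using f(3)[of v] u by auto
    define B' where "B' = insert u (B - {v})"
    have "spanning B'"
      unfolding spanning_def
    proof
      fix x assume x: "x \<in> E - B'"
      show "\<exists>f\<in>L. f x \<noteq> Infty \<and> (\<forall>v. f v \<noteq> Infty \<longrightarrow> v \<in> insert x B')"
      proof (cases "x = v")
        case True
        then show ?thesis using f v(1) unfolding B'_def by blast
      next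
        case False
        then have xB: "x \<notin> B" "x \<noteq> u" using x unfolding B'_def by auto
        then obtain g where g: "g \<in> L" "g x \<noteq> Infty" "\<And>v. g v \<noteq> Infty \<Longrightarrow> v \<in> insert x B"
          using less.prems(1) x unfolding spanning_def by blast
        show ?thesis
        proof (cases "g v = Infty")
          case True
          then show ?thesis using g unfolding B'_def by blast
        next
          case False
          \<comment> \<open>The relation \<open>f\<close> expresses \<open>v\<close> through
            \<open>u\<close> and the rest of \<open>B\<close>; substituting it into the relation
            \<open>g\<close> of \<open>x\<close> removes \<open>v\<close>. The element
            \<open>x\<close> survives because it is outside the support of \<open>f\<close>.\<close>
          obtain h where h: "h \<in> L" "h v = Infty"
            "\<And>z. h z \<noteq> Infty \<Longrightarrow> g z \<noteq> Infty \<or> f z \<noteq> Infty"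
            "\<And>z. g z \<noteq> Infty \<Longrightarrow> f z = Infty \<Longrightarrow> h z \<noteq> Infty"
            using elim_support[OF g(1) f(1) False v(1)] by blast
          have "h x \<noteq> Infty" using h(4) g(2) f(3)[of x] xB by auto
          moreover have "z \<in> insert x B'" if "h z \<noteq> Infty" for z
            using h(2) h(3)[OF that] f(3)[of z] g(3)[of z] that unfolding B'_def by auto
          ultimately show ?thesis using h(1) by blast
        qed
      qed
    qed
    moreover have "B' \<subseteq> E" using u assms(2) less.prems(2) unfolding B'_def by auto
    moreover have "card (A - B') < card (A - B)"
      by (rule psubset_card_mono) (use fin u v vB in \<open>auto simp: B'_def\<close>)
    ultimately have "card A \<le> card B'" by (rule less.hyps[rotated])
    also have "card B' = card B"
      unfolding B'_def using fin vB u(2) by (metis card_insert_disjoint card_Suc_Diff1 finite_Diff DiffD1)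
    finally show ?thesis .
  qed
qed

section \<open>Initial elements and bases of the underlying matroid\<close>

lemma finite_support: "f \<in> L \<Longrightarrow> finite {v. f v \<noteq> Infty}"
  using finite_ground support by (metis (mono_tags, lifting) mem_Collect_eq finite_subset subsetI)

lemma is_init_exists:
  assumes "f \<in> L" "f v \<noteq> Infty"
  obtains u where "is_init \<kappa> \<phi> f u"
proof -
  define S where "S = {v. f v \<noteq> Infty}"
  have S: "finite S" "S \<noteq> {}" using finite_support assms unfolding S_def by auto
  define m where "m = Min (tval \<phi> f ` S)"
  define T where "T = {v \<in> S. tval \<phi> f v = m}"
  have "m \<in> tval \<phi> f ` S" unfolding m_def using S by simp
  then have T: "finite T" "T \<noteq> {}" using S unfolding T_def by auto
  obtain u where u: "u \<in> T" "\<And>x. x \<in> T \<Longrightarrow> \<kappa> u \<le> \<kappa> x"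
    using arg_min_if_finite[OF T, of \<kappa>] by (metis not_less)
  have m_le: "m \<le> tval \<phi> f x" if "x \<in> S" for x
    unfolding m_def using S that by simp
  have "precedes \<kappa> \<phi> f u x" if "x \<noteq> u" "f x \<noteq> Infty" for x
  proof (cases "x \<in> T")
    case True
    have "\<kappa> u \<noteq> \<kappa> x"
      using inj_tiebreak support[OF assms(1)] u(1) that unfolding T_def S_def inj_on_def by blast
    then show ?thesis using u True unfolding precedes_def T_def by fastforce
  next
    case False
    then show ?thesis using m_le[of x] u(1) that(2) unfolding precedes_def T_def S_def by fastforce
  qed
  then have "is_init \<kappa> \<phi> f u" using u(1) unfolding is_init_def T_def S_def by blast
  then show ?thesis by (rule that)
qed

lemma initials_subset: "initials \<kappa> \<phi> L \<subseteq> E"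
  unfolding initials_def is_init_def using support by blast

lemma independent_noninitials: "independent (E - initials \<kappa> \<phi> L)"
  unfolding independent_def
proof (intro ballI impI allI)
  fix f v assume f: "f \<in> L" "\<forall>v. f v \<noteq> Infty \<longrightarrow> v \<in> E - initials \<kappa> \<phi> L"
  show "f v = Infty"
  proof (rule ccontr)
    assume "f v \<noteq> Infty"
    then obtain u where u: "is_init \<kappa> \<phi> f u" using is_init_exists[OF f(1)] by blast
    then have "u \<in> initials \<kappa> \<phi> L" "f u \<noteq> Infty"
      using f(1) unfolding initials_def is_init_def by auto
    then show False using f(2) by blast
  qed
qed

text \<open>Rescale \<open>g\<close> to agree with \<open>f\<close> at \<open>a\<close>. All terms
  of \<open>g\<close> then come at or after \<open>a\<close>, hence strictly after \<open>u\<close>,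
  so eliminating \<open>a\<close> cannot dislodge \<open>u\<close> from its initial place.\<close>

lemma is_init_eliminate:
  assumes f: "f \<in> L" "is_init \<kappa> \<phi> f u" and g: "g \<in> L" "is_init \<kappa> \<phi> g a"
    and a: "f a \<noteq> Infty" "a \<noteq> u"
  obtains h where "h \<in> L" "is_init \<kappa> \<phi> h u" "h a = Infty"
    "\<And>v. h v \<noteq> Infty \<Longrightarrow> f v \<noteq> Infty \<or> g v \<noteq> Infty"
proof -
  have ga: "g a \<noteq> Infty" using g(2) unfolding is_init_def by auto
  obtain c where c: "(\<lambda>v. Fin c * g v) \<in> L" "Fin c * g a = f a"
    using rescale[OF g(1) ga a(1)] by blast
  define g' where "g' = (\<lambda>v. Fin c * g v)"
  have tv: "tval \<phi> g' v = c + tval \<phi> g v" if "g v \<noteq> Infty" for v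
    using that unfolding tval_def g'_def by (cases "g v") auto
  have g': "g' \<in> L" "g' a = f a" "\<And>v. g' v = Infty \<longleftrightarrow> g v = Infty"
    using c unfolding g'_def by auto
  have prec: "precedes \<kappa> \<phi> g' a v" if "v \<noteq> a" "g' v \<noteq> Infty" for v
    using g(2) that tv ga unfolding is_init_def precedes_def g'(3) by fastforce
  obtain h where h: "h \<in> L" "h a = Infty"
    "\<And>v. min (f v) (g' v) \<le> h v" "\<And>v. f v \<noteq> g' v \<Longrightarrow> h v = min (f v) (g' v)"
    using elim[OF f(1) g'(1) g'(2)[symmetric] a(1)] by blast
  have fu: "f u \<noteq> Infty" and ua: "precedes \<kappa> \<phi> f u a"
    using f(2) a unfolding is_init_def by auto
  have eqa: "tval \<phi> g' a = tval \<phi> f a" unfolding tval_def g'(2) ..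
  have fg: "f u < g' u"
  proof (cases "g' u")
    case (Fin y)
    then have "precedes \<kappa> \<phi> g' a u" using prec[of u] a(2) by auto
    \<comment> \<open>If these values were equal, the tie-breaks would give \<kappa> u < \<kappa> a
      < \<kappa> u.\<close>
    then have "tval \<phi> f u < tval \<phi> g' u" using ua eqa unfolding precedes_def by auto
    then show ?thesis using Fin fu unfolding tval_def by (cases "f u") auto
  next
    case Infty
    then show ?thesis using fu by (cases "f u") auto
  qed
  then have hu: "h u = f u" using h(4)[of u] by (auto simp: min_def)
  have "precedes \<kappa> \<phi> h u v" if v: "v \<noteq> u" "h v \<noteq> Infty" for v
  proof -
    have eq: "tval \<phi> h u = tval \<phi> f u" unfolding tval_def hu ..
    consider "f v \<le> h v" | "g' v \<le> h v" using h(3)[of v] by (auto simp: min_def split: if_splits)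
    then show ?thesis
    proof cases
      case 1
      then have "f v \<noteq> Infty" using v by auto
      then have "precedes \<kappa> \<phi> f u v" "tval \<phi> f v \<le> tval \<phi> h v"
        using f(2) v 1 unfolding is_init_def tval_def by (auto simp: trop_neq_Infty_iff) (metis less_eq_trop.simps(1))
      then show ?thesis unfolding precedes_def eq by auto
    next
      case 2
      then have gv: "g' v \<noteq> Infty" using v by auto
      have "v \<noteq> a" using v h(2) by auto
      then have "precedes \<kappa> \<phi> g' a v" using prec gv by auto
      moreover have "tval \<phi> g' v \<le> tval \<phi> h v"
        using gv v 2 unfolding tval_def by (auto simp: trop_neq_Infty_iff) (metis less_eq_trop.simps(1))
      ultimately show ?thesis using ua eqa unfolding precedes_def eq by auto
    qed
  qed
  then have "is_init \<kappa> \<phi> h u" unfolding is_init_def using hu fu by auto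
  moreover have "f v \<noteq> Infty \<or> g v \<noteq> Infty" if "h v \<noteq> Infty" for v
    using h(3)[of v] that g'(3)[of v] by (auto simp: min_def split: if_splits)
  ultimately show ?thesis using that h by blast
qed

text \<open>Gauss-Jordan elimination: a finite set \<open>A\<close> of initial elements is cleared
  from the vectors of all initial \<open>u\<close> at once. To clear a further \<open>a\<close>,
  subtract the vector of \<open>a\<close>; it already vanishes on \<open>A\<close>, so nothing
  cleared before comes back.\<close>

lemma fundamental_vector:
  assumes "u \<in> initials \<kappa> \<phi> L"
  obtains f where "f \<in> L" "f u \<noteq> Infty" "\<And>v. f v \<noteq> Infty \<Longrightarrow> v \<noteq> u \<Longrightarrow> v \<notin> initials \<kappa> \<phi> L"
proof -
  have "finite A \<Longrightarrow> A \<subseteq> initials \<kappa> \<phi> L \<Longrightarrow>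
    \<forall>u\<in>initials \<kappa> \<phi> L. \<exists>f\<in>L. is_init \<kappa> \<phi> f u \<and> (\<forall>v\<in>A. v \<noteq> u \<longrightarrow> f v = Infty)" for A
  proof (induction A rule: finite_induct)
    case empty
    then show ?case unfolding initials_def by auto
  next
    case (insert a A)
    then have IH: "\<forall>u\<in>initials \<kappa> \<phi> L. \<exists>f\<in>L. is_init \<kappa> \<phi> f u \<and> (\<forall>v\<in>A. v \<noteq> u \<longrightarrow> f v = Infty)"
      and a: "a \<in> initials \<kappa> \<phi> L" by auto
    obtain g where g: "g \<in> L" "is_init \<kappa> \<phi> g a" "\<forall>v\<in>A. v \<noteq> a \<longrightarrow> g v = Infty"
      using IH a by blast
    show ?case
    proof
      fix u assume u: "u \<in> initials \<kappa> \<phi> L"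
      obtain f where f: "f \<in> L" "is_init \<kappa> \<phi> f u" "\<forall>v\<in>A. v \<noteq> u \<longrightarrow> f v = Infty"
        using IH u by blast
      show "\<exists>f\<in>L. is_init \<kappa> \<phi> f u \<and> (\<forall>v\<in>insert a A. v \<noteq> u \<longrightarrow> f v = Infty)"
      proof (cases "f a = Infty \<or> a = u")
        case True
        then show ?thesis using f by blast
      next
        case False
        then obtain h where h: "h \<in> L" "is_init \<kappa> \<phi> h u" "h a = Infty"
          "\<And>v. h v \<noteq> Infty \<Longrightarrow> f v \<noteq> Infty \<or> g v \<noteq> Infty"
          using is_init_eliminate[OF f(1,2) g(1,2)] by blast
        then show ?thesis using f(3) g(3) insert.hyps(2) by (metis insert_iff)
      qed
    qed
  qed
  from this[OF finite_subset[OF initials_subset finite_ground] subset_refl] assms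
  show ?thesis using that unfolding is_init_def by blast
qed

lemma spanning_noninitials: "spanning (E - initials \<kappa> \<phi> L)"
  unfolding spanning_def
proof
  fix u assume "u \<in> E - (E - initials \<kappa> \<phi> L)"
  then have "u \<in> initials \<kappa> \<phi> L" by auto
  then obtain f where "f \<in> L" "f u \<noteq> Infty"
    "\<And>v. f v \<noteq> Infty \<Longrightarrow> v \<noteq> u \<Longrightarrow> v \<notin> initials \<kappa> \<phi> L"
    by (rule fundamental_vector) blast
  then show "\<exists>f\<in>L. f u \<noteq> Infty \<and> (\<forall>v. f v \<noteq> Infty \<longrightarrow> v \<in> insert u (E - initials \<kappa> \<phi> L))"
    using support by blast
qed

text \<open>The non-initial elements are independent and spanning, and neither notion mentions the
  weight, so exchange in both directions compares two weights.\<close>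

lemma card_initials: "card (initials \<kappa> \<phi> L) = card (initials \<kappa> \<psi> L)"
proof -
  have "card (E - initials \<kappa> \<phi> L) = card (E - initials \<kappa> \<psi> L)"
    by (intro antisym independent_card_le_spanning independent_noninitials spanning_noninitials) auto
  moreover have "card (E - initials \<kappa> \<theta> L) = card E - card (initials \<kappa> \<theta> L)"
    "card (initials \<kappa> \<theta> L) \<le> card E" for \<theta>
    by (metis card_Diff_subset finite_subset initials_subset finite_ground)
      (simp add: card_mono finite_ground initials_subset)
  ultimately show ?thesis by (metis diff_diff_cancel)
qed

end

section \<open>Finiteness of the set of initial ideals\<close>

text \<open>Every sequence has a monotone subsequence, and a decreasing sequence of naturals is
  constant from its minimum on.\<close>

lemma incseq_subseq_nat:
  fixes s :: "nat \<Rightarrow> nat"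
  obtains r :: "nat \<Rightarrow> nat" where "strict_mono r" "incseq (\<lambda>n. s (r n))"
proof -
  obtain r where r: "strict_mono r" "monoseq (\<lambda>n. s (r n))"
    using seq_monosub[of s] by blast
  show ?thesis
  proof (cases "incseq (\<lambda>n. s (r n))")
    case True
    then show ?thesis using r that by blast
  next
    case False
    then have dec: "decseq (\<lambda>n. s (r n))" using r(2) unfolding monoseq_iff by blast
    define N where "N = (ARG_MIN (\<lambda>n. s (r n)) n. True)"
    have N: "s (r N) \<le> s (r n)" for n
      unfolding N_def by (rule arg_min_nat_le) simp
    have const: "s (r (N + n)) = s (r N)" for n
      using N[of "N + n"] dec unfolding decseq_def by (simp add: antisym)
    show ?thesis
      by (rule that[of "\<lambda>n. r (N + n)"]) (use r(1) const in \<open>auto simp: strict_mono_def incseq_def\<close>)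
  qed
qed

lemma incseq_subseq_coordinates:
  fixes c :: "'i \<Rightarrow> 'x \<Rightarrow> nat" and s :: "nat \<Rightarrow> 'x"
  assumes "finite K"
  shows "\<exists>r. strict_mono (r :: nat \<Rightarrow> nat) \<and> (\<forall>i\<in>K. incseq (\<lambda>n. c i (s (r n))))"
  using assms
proof (induction K rule: finite_induct)
  case empty
  show ?case by (rule exI[of _ id]) (simp add: strict_mono_def)
next
  case (insert k K)
  then obtain r where r: "strict_mono r" "\<forall>i\<in>K. incseq (\<lambda>n. c i (s (r n)))" by blast
  obtain q where q: "strict_mono q" "incseq (\<lambda>n. c k (s (r (q n))))"
    using incseq_subseq_nat[of "\<lambda>n. c k (s (r n))"] by blast
  have "incseq (\<lambda>n. c i (s (r (q n))))" if "i \<in> K" for i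
    using r(2) q(1) that unfolding incseq_def by (simp add: strict_mono_less_eq)
  then show ?case
    using r(1) q by (intro exI[of _ "\<lambda>n. r (q n)"]) (auto simp: strict_mono_def)
qed

text \<open>Without such a \<open>G\<close> one could choose elements greedily, none above an
  earlier one; a subsequence that increases in every coordinate contradicts this. Coordinates are
  arbitrary functions \<open>c i\<close>, so that a degree defect can serve as one of them.\<close>

lemma dickson:
  fixes c :: "'i \<Rightarrow> 'x \<Rightarrow> nat"
  assumes "finite K"
  shows "\<exists>G. finite G \<and> G \<subseteq> M \<and> (\<forall>x\<in>M. \<exists>g\<in>G. \<forall>i\<in>K. c i g \<le> c i x)"
proof -
  define le where "le g x \<longleftrightarrow> (\<forall>i\<in>K. c i g \<le> c i x)" for g x
  have "\<exists>G. finite G \<and> G \<subseteq> M \<and> (\<forall>x\<in>M. \<exists>g\<in>G. le g x)" (is ?P)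
  proof (rule ccontr)
    assume "\<not> ?P"
    then have no: "\<exists>x\<in>M. \<forall>g\<in>G. \<not> le g x" if "finite G" "G \<subseteq> M" for G
      using that by metis
    have "\<exists>s :: nat \<Rightarrow> 'x. \<forall>n. s n \<in> M \<and> (\<forall>j<n. \<not> le (s j) (s n))"
    proof (rule dependent_wellorder_choice)
      fix n and s :: "nat \<Rightarrow> 'x"
      assume "\<And>m. m < n \<Longrightarrow> s m \<in> M \<and> (\<forall>j<m. \<not> le (s j) (s m))"
      then have "finite (s ` {..<n})" "s ` {..<n} \<subseteq> M" by auto
      then obtain x where "x \<in> M" "\<forall>g\<in>s ` {..<n}. \<not> le g x"
        using no by meson
      then show "\<exists>x. x \<in> M \<and> (\<forall>j<n. \<not> le (s j) x)"
        by auto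
    qed simp
    then obtain s :: "nat \<Rightarrow> 'x"
      where s: "\<And>n j. j < n \<Longrightarrow> \<not> le (s j) (s n)" by blast
    obtain r :: "nat \<Rightarrow> nat" where r: "strict_mono r" "\<forall>i\<in>K. incseq (\<lambda>n. c i (s (r n)))"
      using incseq_subseq_coordinates[OF assms] by blast
    have "r 0 < r 1" using r(1) by (simp add: strict_mono_less)
    moreover have "le (s (r 0)) (s (r 1))"
      using r(2) unfolding le_def incseq_def by simp
    ultimately show False using s by blast
  qed
  then show ?thesis unfolding le_def .
qed

text \<open>
  A compactness argument: infinitely many members would accumulate, degree by degree, at a limit
  upset.  Members containing the finitely many generators of the limit contain the limit, and
  equality of the Hilbert functions then forces them to coincide with it.
\<close>

lemma finite_upsets_with_hilbert_function:
  fixes le :: "'x \<Rightarrow> 'x \<Rightarrow> bool" and E :: "nat \<Rightarrow> 'x set"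
  assumes fin: "\<And>d. finite (E d)"
    and gen: "\<And>M. M \<subseteq> (\<Union>d. E d) \<Longrightarrow> \<exists>G. finite G \<and> G \<subseteq> M \<and> (\<forall>x\<in>M. \<exists>g\<in>G. le g x)"
    and sub: "\<And>M. M \<in> F \<Longrightarrow> M \<subseteq> (\<Union>d. E d)"
    and up: "\<And>M x y. M \<in> F \<Longrightarrow> x \<in> M \<Longrightarrow> y \<in> (\<Union>d. E d) \<Longrightarrow> le x y \<Longrightarrow> y \<in> M"
    and card: "\<And>M d. M \<in> F \<Longrightarrow> card (M \<inter> E d) = H d"
  shows "finite F"
proof (rule ccontr)
  assume inf: "infinite F"
  \<comment> \<open>In the application the sets \<open>E d\<close> are disjoint copies, so nested
    windows are obtained from their unions.\<close>
  define X where "X D = (\<Union>d\<le>D. E d)" for D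
  have finX: "finite (X D)" for D unfolding X_def using fin by simp
  have X_mono: "X D \<subseteq> X D'" if "D \<le> D'" for D D' unfolding X_def using that by (auto intro: order_trans)
  have pigeon: "\<exists>S. infinite {M \<in> A. M \<inter> X D = S}" if "infinite A" for A D
  proof -
    have "finite ((\<lambda>M. M \<inter> X D) ` A)"
      by (rule finite_subset[of _ "Pow (X D)"]) (use finX in auto)
    then show ?thesis using pigeonhole_infinite[OF that] by blast
  qed
  \<comment> \<open>As in Koenig's lemma: each window has finitely many subsets, so a trace shared
    by infinitely many members can always be refined to the next window.\<close>
  have "\<exists>P. \<forall>D. infinite {M \<in> F. M \<inter> X D = P D} \<and> P (Suc D) \<inter> X D = P D"
  proof (rule dependent_nat_choice)
    show "\<exists>S. infinite {M \<in> F. M \<inter> X 0 = S}" using pigeon[OF inf] .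
  next
    fix S D assume S: "infinite {M \<in> F. M \<inter> X D = S}"
    obtain S' where S': "infinite {M \<in> {M \<in> F. M \<inter> X D = S}. M \<inter> X (Suc D) = S'}"
      using pigeon[OF S] by blast
    then obtain M where "M \<inter> X D = S" "M \<inter> X (Suc D) = S'"
      using infinite_imp_nonempty[OF S'] by blast
    then have "S' \<inter> X D = S" using X_mono[of D "Suc D"] by auto
    moreover have "infinite {M \<in> F. M \<inter> X (Suc D) = S'}"
      by (rule infinite_super[OF _ S']) auto
    ultimately show "\<exists>S'. infinite {M \<in> F. M \<inter> X (Suc D) = S'} \<and> S' \<inter> X D = S" by blast
  qed
  then obtain P where P: "\<And>D. infinite {M \<in> F. M \<inter> X D = P D}" "\<And>D. P (Suc D) \<inter> X D = P D"
    by blast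
  have P_sub: "P D \<subseteq> X D" for D
    using infinite_imp_nonempty[OF P(1)[of D]] by blast
  define N where "N = (\<Union>D. P D)"
  have P_add: "P (D + k) \<inter> X D = P D" for D k
  proof (induction k)
    case 0
    then show ?case using P_sub[of D] by auto
  next
    case (Suc k)
    have "P (D + Suc k) \<inter> X D = P (Suc (D + k)) \<inter> X (D + k) \<inter> X D"
      using X_mono[of D "D + k"] by auto
    then show ?case using Suc P(2)[of "D + k"] by simp
  qed
  have P_le: "P D' \<inter> X D \<subseteq> P D" for D D'
  proof (cases "D \<le> D'")
    case True
    then show ?thesis using P_add[of D "D' - D"] by simp
  next
    case False
    then show ?thesis using P_add[of D' "D - D'"] P_sub[of D'] by auto
  qed
  have N_X: "N \<inter> X D = P D" for D
    unfolding N_def using P_le P_sub[of D] by blast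
  have N_sub: "N \<subseteq> (\<Union>D. E D)" unfolding N_def using P_sub unfolding X_def by blast
  have cardN: "card (N \<inter> E d) = H d" for d
  proof -
    obtain M where M: "M \<in> F" "M \<inter> X d = P d"
      using infinite_imp_nonempty[OF P(1)[of d]] by blast
    have "E d \<subseteq> X d" unfolding X_def by auto
    then have "M \<inter> E d = N \<inter> E d" using M(2) N_X[of d] by blast
    then show ?thesis using card[OF M(1), of d] by simp
  qed
  obtain G where G: "finite G" "G \<subseteq> N" "\<forall>x\<in>N. \<exists>g\<in>G. le g x" using gen[OF N_sub] by blast
  have "\<exists>D. G \<subseteq> X D"
    using G(1,2)
  proof (induction G rule: finite_induct)
    case (insert g G)
    then obtain D d where "G \<subseteq> X D" "g \<in> E d" using N_sub by auto
    moreover have "E d \<subseteq> X d" unfolding X_def by auto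
    ultimately show ?case
      using X_mono[of D "max D d"] X_mono[of d "max D d"] by (intro exI[of _ "max D d"]) auto
  qed auto
  then obtain D where D: "G \<subseteq> X D" by blast
  have "M = N" if M: "M \<in> F" "M \<inter> X D = P D" for M
  proof -
    have "G \<subseteq> M" using G(2) D M(2) N_X[of D] by blast
    have "N \<subseteq> M"
    proof
      fix x assume x: "x \<in> N"
      then obtain g where "g \<in> G" "le g x" using G(3) by blast
      then show "x \<in> M" using up[OF M(1), of g x] \<open>G \<subseteq> M\<close> N_sub x by blast
    qed
    moreover have "M \<inter> E d = N \<inter> E d" for d
      using card_subset_eq[of "M \<inter> E d" "N \<inter> E d"] fin card[OF M(1)] cardN \<open>N \<subseteq> M\<close> by auto
    ultimately show ?thesis using sub[OF M(1)] by blast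
  qed
  then have "{M \<in> F. M \<inter> X D = P D} \<subseteq> {N}" by blast
  then have "finite {M \<in> F. M \<inter> X D = P D}" by (rule finite_subset) simp
  then show False using P(1)[of D] by simp
qed

section \<open>The Groebner complex\<close>

lemma monomial_degree_add: "monomial_degree (u + v) = monomial_degree u + monomial_degree v"
  unfolding monomial_degree_def by (simp add: lookup_add sum.distrib)

definition exponent :: "('n::finite \<Rightarrow>\<^sub>0 nat) \<Rightarrow> real ^ 'n" where
  "exponent u = (\<chi> i. real (Poly_Mapping.lookup u i))"

lemma exponent_add: "exponent (u + v) = exponent u + exponent v"
  by (simp add: exponent_def vec_eq_iff lookup_add)

abbreviation wval :: "real ^ 'n::finite \<Rightarrow> (('n \<Rightarrow>\<^sub>0 nat) \<Rightarrow> trop) \<Rightarrow> ('n \<Rightarrow>\<^sub>0 nat) \<Rightarrow> real" where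
  "wval w \<equiv> tval (\<lambda>u. w \<bullet> exponent u)"

lemma wval_segment:
  "wval ((1 - t) *\<^sub>R w + t *\<^sub>R w') f u = (1 - t) * wval w f u + t * wval w' f u"
  by (simp add: tval_def inner_add_left algebra_simps)

lemma wval_segment_tendsto:
  "((\<lambda>t. wval ((1 - t) *\<^sub>R w + t *\<^sub>R w') f u) \<longlongrightarrow> wval w f u) (at_right 0)"
proof -
  have "((\<lambda>t. (1 - t) * wval w f u + t * wval w' f u) \<longlongrightarrow> (1 - 0) * wval w f u + 0 * wval w' f u) (at_right 0)"
    by (intro tendsto_intros)
  then show ?thesis by (simp only: wval_segment) simp
qed

lemma wval_less_near:
  assumes "wval w f u < wval w g v"
  shows "\<forall>\<^sub>F t in at_right 0. wval ((1 - t) *\<^sub>R w + t *\<^sub>R w') f u < wval ((1 - t) *\<^sub>R w + t *\<^sub>R w') g v"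
proof -
  let ?m = "(wval w f u + wval w g v) / 2"
  have "\<forall>\<^sub>F t in at_right 0. wval ((1 - t) *\<^sub>R w + t *\<^sub>R w') f u < ?m"
    by (rule order_tendstoD(2)[OF wval_segment_tendsto]) (use assms in simp)
  moreover have "\<forall>\<^sub>F t in at_right 0. ?m < wval ((1 - t) *\<^sub>R w + t *\<^sub>R w') g v"
    by (rule order_tendstoD(1)[OF wval_segment_tendsto]) (use assms in simp)
  ultimately show ?thesis by eventually_elim simp
qed

lemma le_of_le_segment:
  fixes a b a' b' :: real
  assumes "\<And>t. 0 < t \<Longrightarrow> t \<le> 1 \<Longrightarrow> (1 - t) * a + t * a' \<le> (1 - t) * b + t * b'"
  shows "a \<le> b"
proof (rule tendsto_le)
  show "((\<lambda>t. (1 - t) * a + t * a') \<longlongrightarrow> a) (at_right 0)"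
    "((\<lambda>t. (1 - t) * b + t * b') \<longlongrightarrow> b) (at_right 0)"
    by (auto intro!: tendsto_eq_intros)
  have "\<forall>\<^sub>F t in at_right 0. t \<in> {0 <..< (1::real)}"
    by (rule eventually_at_right_real) simp
  then show "\<forall>\<^sub>F t in at_right 0. (1 - t) * a + t * a' \<le> (1 - t) * b + t * b'"
    by eventually_elim (use assms in simp)
qed simp

lemma polyhedron_wval_le: "polyhedron {w. wval w f u \<le> wval w f v}"
proof -
  have "{w. wval w f u \<le> wval w f v} =
      {w. (exponent u - exponent v) \<bullet> w \<le> real_part (f v) - real_part (f u)}"
    by (auto simp: tval_def inner_diff_left inner_diff_right inner_commute algebra_simps)
  then show ?thesis by (simp add: polyhedron_halfspace_le)
qed

text \<open>No tie-break here: one term lies strictly below all others, which is how a point fails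
  to lie in a variety.\<close>

definition monomial_init :: "real ^ 'n::finite \<Rightarrow> (('n \<Rightarrow>\<^sub>0 nat) \<Rightarrow> trop) \<Rightarrow> ('n \<Rightarrow>\<^sub>0 nat) \<Rightarrow> bool" where
  "monomial_init w f u \<longleftrightarrow> f u \<noteq> Infty \<and> (\<forall>v. v \<noteq> u \<longrightarrow> f v \<noteq> Infty \<longrightarrow> wval w f u < wval w f v)"

text \<open>\<open>shift\<close> is multiplication by the monomial \<open>m\<close>, phrased for
  coefficient functions. It is asked for only when \<open>u + m\<close> is in \<open>E d'\<close>
  for some \<open>u\<close> in \<open>E d\<close>; in the application this forces \<open>m\<close>
  to avoid the deleted variables.\<close>

locale graded_vectors =
  fixes E :: "nat \<Rightarrow> ('n::finite \<Rightarrow>\<^sub>0 nat) set"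
    and L :: "nat \<Rightarrow> (('n \<Rightarrow>\<^sub>0 nat) \<Rightarrow> trop) set"
    and \<kappa> :: "('n \<Rightarrow>\<^sub>0 nat) \<Rightarrow> real"
  assumes vectors: "\<And>d. valuated_vectors (E d) (L d) \<kappa>"
    and degree_le: "\<And>u d. u \<in> E d \<Longrightarrow> monomial_degree u \<le> d"
    and tiebreak_add: "\<And>u v. \<kappa> (u + v) = \<kappa> u + \<kappa> v"
    and shift: "\<And>f d d' u m. f \<in> L d \<Longrightarrow> u \<in> E d \<Longrightarrow> u + m \<in> E d' \<Longrightarrow> d + monomial_degree m \<le> d' \<Longrightarrow>
      \<exists>g\<in>L d'. (\<forall>v. g (v + m) = f v) \<and> (\<forall>v. g v \<noteq> Infty \<longrightarrow> (\<exists>x. v = x + m))"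
begin

text \<open>The pair \<open>(d, u)\<close> is a homogenized monomial:
  \<open>d - monomial_degree u\<close> is the exponent of an additional variable. In these terms the
  set is a monomial ideal.\<close>

definition initial_set :: "real ^ 'n \<Rightarrow> (nat \<times> ('n \<Rightarrow>\<^sub>0 nat)) set" where
  "initial_set w = {(d, u). u \<in> initials \<kappa> (\<lambda>u. w \<bullet> exponent u) (L d)}"

lemma initial_set_ground: "(d, u) \<in> initial_set w \<Longrightarrow> u \<in> E d"
  using valuated_vectors.initials_subset[OF vectors] unfolding initial_set_def by blast

text \<open>Multiplication by \<open>m\<close> adds the constants
  \<open>w \<bullet> exponent m\<close> and \<open>\<kappa> m\<close> to the two keys of the
  comparison, so the order of the terms is unchanged.\<close>

lemma initial_set_shift:
  assumes "(d, u) \<in> initial_set w" "u + m \<in> E d'" "d + monomial_degree m \<le> d'"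
  shows "(d', u + m) \<in> initial_set w"
proof -
  obtain f where f: "f \<in> L d" "is_init \<kappa> (\<lambda>u. w \<bullet> exponent u) f u"
    using assms(1) unfolding initial_set_def initials_def by auto
  obtain g where g: "g \<in> L d'" "\<And>v. g (v + m) = f v" "\<And>v. g v \<noteq> Infty \<Longrightarrow> \<exists>x. v = x + m"
    using shift[OF f(1) initial_set_ground[OF assms(1)] assms(2,3)] by blast
  have val: "wval w g (v + m) = wval w f v + w \<bullet> exponent m" for v
    by (simp add: tval_def g(2) exponent_add inner_add_right)
  have "precedes \<kappa> (\<lambda>u. w \<bullet> exponent u) g (u + m) v" if v: "v \<noteq> u + m" "g v \<noteq> Infty" for v
  proof -
    obtain x where x: "v = x + m" using g(3) v(2) by blast
    then have "x \<noteq> u" "f x \<noteq> Infty" using v g(2) by auto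
    then have "precedes \<kappa> (\<lambda>u. w \<bullet> exponent u) f u x" using f(2) unfolding is_init_def by blast
    then show ?thesis unfolding precedes_def x val by (auto simp: tiebreak_add)
  qed
  moreover have "g (u + m) \<noteq> Infty" using f(2) g(2) unfolding is_init_def by auto
  ultimately have "is_init \<kappa> (\<lambda>u. w \<bullet> exponent u) g (u + m)" unfolding is_init_def by blast
  then show ?thesis using g(1) unfolding initial_set_def initials_def by blast
qed

text \<open>Divisibility of homogenized monomials: the degree condition compares the exponents of
  the additional variable.\<close>

definition graded_le :: "nat \<times> ('n \<Rightarrow>\<^sub>0 nat) \<Rightarrow> nat \<times> ('n \<Rightarrow>\<^sub>0 nat) \<Rightarrow> bool" where
  "graded_le p q \<longleftrightarrow> (\<exists>m. snd q = snd p + m \<and> fst p + monomial_degree m \<le> fst q)"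

lemma graded_generators:
  assumes "M \<subseteq> (\<Union>d. {d} \<times> E d)"
  shows "\<exists>G. finite G \<and> G \<subseteq> M \<and> (\<forall>x\<in>M. \<exists>g\<in>G. graded_le g x)"
proof -
  define c :: "'n option \<Rightarrow> nat \<times> ('n \<Rightarrow>\<^sub>0 nat) \<Rightarrow> nat" where
    \<comment> \<open>\<open>None\<close> is the coordinate of the homogenizing variable.\<close>
    "c i p = (case i of None \<Rightarrow> fst p - monomial_degree (snd p) | Some j \<Rightarrow> Poly_Mapping.lookup (snd p) j)"
    for i p
  have "finite (UNIV :: 'n option set)" by simp
  from dickson[OF this, of M c] obtain G where
    G: "finite G" "G \<subseteq> M" "\<And>x. x \<in> M \<Longrightarrow> \<exists>g\<in>G. \<forall>i. c i g \<le> c i x" by auto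
  have "graded_le g x" if gx: "g \<in> M" "x \<in> M" "\<forall>i. c i g \<le> c i x" for g x
  proof -
    have *: "Poly_Mapping.lookup (snd g) j \<le> Poly_Mapping.lookup (snd x) j" for j
      using gx(3)[rule_format, of "Some j"] by (simp add: c_def)
    define m where "m = snd x - snd g"
    have m: "snd x = snd g + m"
      unfolding m_def by (rule poly_mapping_eqI) (simp add: lookup_add lookup_minus *)
    have "fst g - monomial_degree (snd g) \<le> fst x - monomial_degree (snd x)"
      using gx(3)[rule_format, of None] by (simp add: c_def)
    \<comment> \<open>These bounds ensure that the subtractions of naturals above are not
      truncated.\<close>
    moreover have "monomial_degree (snd g) \<le> fst g" "monomial_degree (snd x) \<le> fst x"
      using gx assms degree_le by auto
    ultimately show ?thesis
      unfolding graded_le_def using m monomial_degree_add[of "snd g" m] by (intro exI[of _ m]) simp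
  qed
  then show ?thesis using G by (metis subsetD)
qed

section \<open>The Hilbert function of the initial sets\<close>

lemma initial_set_subset: "initial_set w \<subseteq> (\<Union>d. {d} \<times> E d)"
  using initial_set_ground by auto

text \<open>The weight 0 serves as the reference point: the right-hand side no longer mentions
  \<open>w\<close>.\<close>

lemma initial_set_degree_part:
  "card (initial_set w \<inter> {d} \<times> E d) = card (initials \<kappa> (\<lambda>_. 0) (L d))"
proof -
  have "initial_set w \<inter> {d} \<times> E d = Pair d ` initials \<kappa> (\<lambda>u. w \<bullet> exponent u) (L d)"
    using valuated_vectors.initials_subset[OF vectors] unfolding initial_set_def by auto
  then have "card (initial_set w \<inter> {d} \<times> E d) = card (initials \<kappa> (\<lambda>u. w \<bullet> exponent u) (L d))"
    by (simp add: card_image inj_on_def)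
  then show ?thesis using valuated_vectors.card_initials[OF vectors] by metis
qed

lemma finite_ground_set: "finite (E d)"
  using vectors valuated_vectors.finite_ground by blast

lemma initial_set_upward:
  assumes "p \<in> initial_set w" "q \<in> (\<Union>d. {d} \<times> E d)" "graded_le p q"
  shows "q \<in> initial_set w"
proof -
  obtain d u where q: "q = (d, u)" "u \<in> E d" using assms(2) by auto
  obtain m where "u = snd p + m" "fst p + monomial_degree m \<le> d"
    using assms(3) q(1) unfolding graded_le_def by auto
  then show ?thesis using initial_set_shift[of "fst p" "snd p" w m d] assms(1) q by simp
qed

lemma finite_initial_sets: "finite (range initial_set)"
proof (rule finite_upsets_with_hilbert_function[where E = "\<lambda>d. {d} \<times> E d" and le = graded_le])
  show "finite ({d} \<times> E d)" for d by (simp add: finite_ground_set)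
  show "\<exists>G. finite G \<and> G \<subseteq> M \<and> (\<forall>x\<in>M. \<exists>g\<in>G. graded_le g x)" if "M \<subseteq> (\<Union>d. {d} \<times> E d)" for M
    by (rule graded_generators[OF that])
  show "M \<subseteq> (\<Union>d. {d} \<times> E d)" if "M \<in> range initial_set" for M
    using that initial_set_subset by auto
  show "y \<in> M" if M: "M \<in> range initial_set" "x \<in> M" "y \<in> (\<Union>d. {d} \<times> E d)" "graded_le x y" for M x y
  proof -
    obtain w where "M = initial_set w" using M(1) by blast
    then show ?thesis using initial_set_upward[of x w y] M(2-4) by simp
  qed
  show "card (M \<inter> {d} \<times> E d) = card (initials \<kappa> (\<lambda>_. 0) (L d))" if "M \<in> range initial_set" for M d
    using that initial_set_degree_part by auto
qed

text \<open>The two sets have equally many elements in each degree, and these numbers are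
  finite.\<close>

lemma initial_set_eqI:
  assumes "initial_set w \<subseteq> initial_set w'"
  shows "initial_set w' = initial_set w"
proof -
  have "initial_set w \<inter> {d} \<times> E d = initial_set w' \<inter> {d} \<times> E d" for d
    by (rule card_subset_eq) (use assms finite_ground_set initial_set_degree_part in auto)
  then show ?thesis using initial_set_subset by blast
qed

text \<open>Indexed by \<open>M\<close> rather than by a weight, so that a single choice serves all
  weights with initial set \<open>M\<close>.\<close>

definition fundamental :: "(nat \<times> ('n \<Rightarrow>\<^sub>0 nat)) set \<Rightarrow> nat \<Rightarrow> ('n \<Rightarrow>\<^sub>0 nat) \<Rightarrow> ('n \<Rightarrow>\<^sub>0 nat) \<Rightarrow> trop" where
  "fundamental M d u = (SOME f. f \<in> L d \<and> f u \<noteq> Infty \<and> (\<forall>v. f v \<noteq> Infty \<longrightarrow> v \<noteq> u \<longrightarrow> (d, v) \<notin> M))"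

lemma fundamental:
  assumes "(d, u) \<in> initial_set w"
  shows "fundamental (initial_set w) d u \<in> L d" "fundamental (initial_set w) d u u \<noteq> Infty"
    "\<And>v. fundamental (initial_set w) d u v \<noteq> Infty \<Longrightarrow> v \<noteq> u \<Longrightarrow> (d, v) \<notin> initial_set w"
proof -
  have "u \<in> initials \<kappa> (\<lambda>u. w \<bullet> exponent u) (L d)" using assms unfolding initial_set_def by simp
  then have "\<exists>f. f \<in> L d \<and> f u \<noteq> Infty \<and> (\<forall>v. f v \<noteq> Infty \<longrightarrow> v \<noteq> u \<longrightarrow> (d, v) \<notin> initial_set w)"
    by (rule valuated_vectors.fundamental_vector[OF vectors]) (auto simp: initial_set_def)
  from someI_ex[OF this] show "fundamental (initial_set w) d u \<in> L d" "fundamental (initial_set w) d u u \<noteq> Infty"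
    "\<And>v. fundamental (initial_set w) d u v \<noteq> Infty \<Longrightarrow> v \<noteq> u \<Longrightarrow> (d, v) \<notin> initial_set w"
    unfolding fundamental_def by auto
qed

lemma initial_setI: "f \<in> L d \<Longrightarrow> is_init \<kappa> (\<lambda>u. w \<bullet> exponent u) f u \<Longrightarrow> (d, u) \<in> initial_set w"
  unfolding initial_set_def initials_def by blast

text \<open>The initial monomial of the fundamental vector belongs to the initial set, and
  \<open>u\<close> is the only such monomial in its support.\<close>

lemma fundamental_init:
  assumes "(d, u) \<in> initial_set w"
  shows "is_init \<kappa> (\<lambda>u. w \<bullet> exponent u) (fundamental (initial_set w) d u) u"
proof -
  obtain x where x: "is_init \<kappa> (\<lambda>u. w \<bullet> exponent u) (fundamental (initial_set w) d u) x"
    using valuated_vectors.is_init_exists[OF vectors fundamental(1,2)[OF assms]] by blast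
  then have "(d, x) \<in> initial_set w" using initial_setI fundamental(1)[OF assms] by blast
  then have "x = u" using fundamental(3)[OF assms, of x] x unfolding is_init_def by blast
  then show ?thesis using x by simp
qed

text \<open>Weak inequalities without tie-break, so that the resulting cell is closed; it contains
  all weights with initial set \<open>M\<close> and possibly others.\<close>

definition min_at :: "(nat \<times> ('n \<Rightarrow>\<^sub>0 nat)) set \<Rightarrow> nat \<times> ('n \<Rightarrow>\<^sub>0 nat) \<Rightarrow> (real ^ 'n) set" where
  "min_at M p = {w. \<forall>v. fundamental M (fst p) (snd p) v \<noteq> Infty \<longrightarrow>
     wval w (fundamental M (fst p) (snd p)) (snd p) \<le> wval w (fundamental M (fst p) (snd p)) v}"

definition groebner_cell :: "(nat \<times> ('n \<Rightarrow>\<^sub>0 nat)) set \<Rightarrow> (real ^ 'n) set" where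
  "groebner_cell M = (\<Inter>p\<in>M. min_at M p)"

lemma is_init_le:
  "is_init \<kappa> \<phi> f u \<Longrightarrow> f v \<noteq> Infty \<Longrightarrow> tval \<phi> f u \<le> tval \<phi> f v"
  unfolding is_init_def precedes_def by (cases "v = u") auto

lemma initial_set_in_cell: "w \<in> groebner_cell (initial_set w)"
  unfolding groebner_cell_def min_at_def using fundamental_init is_init_le by fastforce

text \<open>For a generator, the weak inequalities at \<open>w\<close> and the tie-broken ones at
  \<open>w0\<close> combine to tie-broken ones on the segment, as soon as \<open>w0\<close> has
  positive weight \<open>t\<close>. Upward closure then gives all of \<open>M\<close>, and counting
  excludes anything else.\<close>

lemma initial_set_segment:
  fixes w0 :: "real ^ 'n"
  defines "M \<equiv> initial_set w0"
  assumes G: "G \<subseteq> M" "\<And>x. x \<in> M \<Longrightarrow> \<exists>g\<in>G. graded_le g x"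
    and w: "\<And>p. p \<in> G \<Longrightarrow> w \<in> min_at M p" and t: "0 < t" "t \<le> 1"
  shows "initial_set ((1 - t) *\<^sub>R w + t *\<^sub>R w0) = M"
proof -
  let ?w = "(1 - t) *\<^sub>R w + t *\<^sub>R w0"
  have "(d, u) \<in> initial_set ?w" if du: "(d, u) \<in> G" for d u
  proof -
    have M: "(d, u) \<in> initial_set w0" using du G(1) unfolding M_def by blast
    let ?f = "fundamental M d u"
    have init: "is_init \<kappa> (\<lambda>u. w0 \<bullet> exponent u) ?f u" using fundamental_init[OF M] unfolding M_def .
    have "precedes \<kappa> (\<lambda>u. ?w \<bullet> exponent u) ?f u v" if v: "v \<noteq> u" "?f v \<noteq> Infty" for v
    proof -
      have "wval w ?f u \<le> wval w ?f v"
        using w[OF du] v unfolding min_at_def by simp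
      then have le: "(1 - t) * wval w ?f u \<le> (1 - t) * wval w ?f v"
        using t by (simp add: mult_left_mono)
      have "precedes \<kappa> (\<lambda>u. w0 \<bullet> exponent u) ?f u v" using init v unfolding is_init_def by blast
      then consider "wval w0 ?f u < wval w0 ?f v" | "wval w0 ?f u = wval w0 ?f v" "\<kappa> u < \<kappa> v"
        unfolding precedes_def by blast
      then show ?thesis
      proof cases
        case 1
        then have "t * wval w0 ?f u < t * wval w0 ?f v" using t by simp
        then show ?thesis unfolding precedes_def wval_segment using le by linarith
      next
        case 2
        then show ?thesis unfolding precedes_def wval_segment using le by auto
      qed
    qed
    then have "is_init \<kappa> (\<lambda>u. ?w \<bullet> exponent u) ?f u" using init unfolding is_init_def by blast
    then show ?thesis by (rule initial_setI[rotated]) (use fundamental(1)[OF M] in \<open>simp add: M_def\<close>)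
  qed
  then have "G \<subseteq> initial_set ?w" by auto
  have "initial_set w0 \<subseteq> initial_set ?w"
  proof
    fix x assume x: "x \<in> initial_set w0"
    then obtain g where g: "g \<in> G" "graded_le g x" using G(2) unfolding M_def by blast
    show "x \<in> initial_set ?w"
      by (rule initial_set_upward[of g]) (use g x \<open>G \<subseteq> initial_set ?w\<close> initial_set_subset in blast)+
  qed
  then show ?thesis unfolding M_def by (rule initial_set_eqI)
qed

text \<open>The points of the segment towards \<open>w0\<close>, except perhaps \<open>w\<close>
  itself, have initial set \<open>M\<close> and so satisfy the inequalities for every element of
  \<open>M\<close>; letting \<open>t\<close> tend to 0 transfers these to \<open>w\<close>.\<close>

lemma groebner_cell_generators:
  assumes G: "G \<subseteq> initial_set w0" "\<And>x. x \<in> initial_set w0 \<Longrightarrow> \<exists>g\<in>G. graded_le g x"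
  shows "groebner_cell (initial_set w0) = (\<Inter>p\<in>G. min_at (initial_set w0) p)"
proof
  let ?M = "initial_set w0"
  show "groebner_cell ?M \<subseteq> (\<Inter>p\<in>G. min_at ?M p)"
    unfolding groebner_cell_def using G(1) by blast
  show "(\<Inter>p\<in>G. min_at ?M p) \<subseteq> groebner_cell ?M"
  proof
    fix w assume "w \<in> (\<Inter>p\<in>G. min_at ?M p)"
    then have w: "\<And>p. p \<in> G \<Longrightarrow> w \<in> min_at ?M p" by blast
    have "wval w (fundamental ?M d u) u \<le> wval w (fundamental ?M d u) v"
      if du: "(d, u) \<in> ?M" and v: "fundamental ?M d u v \<noteq> Infty" for d u v
    proof (rule le_of_le_segment)
      fix t :: real assume t: "0 < t" "t \<le> 1"
      let ?w = "(1 - t) *\<^sub>R w + t *\<^sub>R w0"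
      have eq: "initial_set ?w = ?M" by (rule initial_set_segment[OF G w t])
      have "is_init \<kappa> (\<lambda>u. ?w \<bullet> exponent u) (fundamental ?M d u) u"
        using fundamental_init[of d u ?w] du unfolding eq by simp
      from is_init_le[OF this v] show "(1 - t) * wval w (fundamental ?M d u) u + t * wval w0 (fundamental ?M d u) u
          \<le> (1 - t) * wval w (fundamental ?M d u) v + t * wval w0 (fundamental ?M d u) v"
        unfolding wval_segment .
    qed
    then show "w \<in> groebner_cell ?M" unfolding groebner_cell_def min_at_def by auto
  qed
qed

lemma groebner_cell_segment:
  assumes "w \<in> groebner_cell (initial_set w0)" "0 < t" "t \<le> 1"
  shows "initial_set ((1 - t) *\<^sub>R w + t *\<^sub>R w0) = initial_set w0"
proof (rule initial_set_segment[OF subset_refl _ _ assms(2,3)])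
  fix x assume "x \<in> initial_set w0"
  then show "\<exists>g\<in>initial_set w0. graded_le g x"
    by (intro bexI[of _ x]) (auto simp: graded_le_def monomial_degree_def intro!: exI[of _ 0])
qed (use assms(1) in \<open>auto simp: groebner_cell_def\<close>)

lemma polyhedron_groebner_cell: "polyhedron (groebner_cell (initial_set w0))"
proof -
  let ?M = "initial_set w0"
  obtain G where G: "finite G" "G \<subseteq> ?M" "\<And>x. x \<in> ?M \<Longrightarrow> \<exists>g\<in>G. graded_le g x"
    using graded_generators[OF initial_set_subset, of w0] by blast
  have "polyhedron (min_at ?M p)" if p: "p \<in> G" for p
  proof -
    obtain d u where du: "p = (d, u)" "(d, u) \<in> ?M" using p G(2) by (cases p) auto
    let ?f = "fundamental ?M d u"
    have "finite {v. ?f v \<noteq> Infty}"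
      using valuated_vectors.finite_support[OF vectors fundamental(1)[OF du(2)]] .
    moreover have "min_at ?M p = (\<Inter>v\<in>{v. ?f v \<noteq> Infty}. {w. wval w ?f u \<le> wval w ?f v})"
      unfolding min_at_def du(1) by auto
    ultimately show ?thesis by (auto intro!: polyhedron_Inter polyhedron_wval_le)
  qed
  moreover have "groebner_cell ?M = (\<Inter>p\<in>G. min_at ?M p)"
    by (rule groebner_cell_generators[OF G(2)]) (rule G(3))
  ultimately show ?thesis using G(1) by (simp only:) (rule polyhedron_Inter, auto)
qed

section \<open>Weights at which no initial form is a monomial\<close>

definition monomial_free :: "(real ^ 'n) set" where
  "monomial_free = {w. \<forall>d. \<forall>f\<in>L d. \<forall>u. \<not> monomial_init w f u}"

text \<open>
  If every fundamental vector has a tie at \<open>w\<close>, a vector with initial form \<open>u\<close> could be used to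
  eliminate \<open>u\<close> from the fundamental vector of \<open>u\<close>; the result would have its initial form at \<open>w\<close>
  supported outside \<open>M\<close>, which is impossible for weights near \<open>w\<close> with initial set \<open>M\<close>.
\<close>

lemma monomial_free_in_cell:
  assumes w: "w \<in> groebner_cell (initial_set w0)"
  shows "w \<in> monomial_free \<longleftrightarrow>
    (\<forall>d u. (d, u) \<in> initial_set w0 \<longrightarrow>
      (\<exists>v. v \<noteq> u \<and> fundamental (initial_set w0) d u v \<noteq> Infty \<and>
        wval w (fundamental (initial_set w0) d u) u = wval w (fundamental (initial_set w0) d u) v))"
proof (intro iffI allI impI)
  let ?M = "initial_set w0"
  fix d u assume free: "w \<in> monomial_free" and du: "(d, u) \<in> ?M"
  then have "\<not> monomial_init w (fundamental ?M d u) u"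
    using fundamental(1) unfolding monomial_free_def by blast
  then obtain v where v: "v \<noteq> u" "fundamental ?M d u v \<noteq> Infty" "wval w (fundamental ?M d u) v \<le> wval w (fundamental ?M d u) u"
    using fundamental(2)[OF du] unfolding monomial_init_def by (auto simp: not_less)
  moreover have "w \<in> min_at ?M (d, u)" using w du unfolding groebner_cell_def by blast
  ultimately show "\<exists>v. v \<noteq> u \<and> fundamental ?M d u v \<noteq> Infty \<and> wval w (fundamental ?M d u) u = wval w (fundamental ?M d u) v"
    unfolding min_at_def by (intro exI[of _ v]) (simp add: antisym)
next
  let ?M = "initial_set w0"
  define seg where "seg t = (1 - t) *\<^sub>R w + t *\<^sub>R w0" for t
  assume ties: "\<forall>d u. (d, u) \<in> ?M \<longrightarrow> (\<exists>v. v \<noteq> u \<and> fundamental ?M d u v \<noteq> Infty \<and>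
        wval w (fundamental ?M d u) u = wval w (fundamental ?M d u) v)"
  have t01: "\<forall>\<^sub>F t in at_right 0. t \<in> {0 <..< (1::real)}"
    by (rule eventually_at_right_real) simp
  have seg_M: "initial_set (seg t) = ?M" if "t \<in> {0<..<1}" for t
    unfolding seg_def by (rule groebner_cell_segment[OF w]) (use that in auto)
  \<comment> \<open>Only finitely many pairs from \<open>E d\<close> occur, so all strict
    comparisons at \<open>w\<close> persist together at some point of the segment.\<close>
  have near: "\<exists>t. t \<in> {0<..<1} \<and> (\<forall>(x, y)\<in>E d \<times> E d. wval w f x < wval w f y \<longrightarrow> wval (seg t) f x < wval (seg t) f y)"
    for d f
  proof -
    have "\<forall>\<^sub>F t in at_right 0. \<forall>p\<in>E d \<times> E d. wval w f (fst p) < wval w f (snd p) \<longrightarrow> wval (seg t) f (fst p) < wval (seg t) f (snd p)"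
    proof (intro eventually_ball_finite ballI)
      fix p
      show "\<forall>\<^sub>F t in at_right 0. wval w f (fst p) < wval w f (snd p) \<longrightarrow> wval (seg t) f (fst p) < wval (seg t) f (snd p)"
        unfolding seg_def by (cases "wval w f (fst p) < wval w f (snd p)") (simp_all add: wval_less_near)
    qed (simp add: finite_ground_set)
    with t01 have "\<forall>\<^sub>F t in at_right 0. t \<in> {0<..<1} \<and> (\<forall>p\<in>E d \<times> E d. wval w f (fst p) < wval w f (snd p) \<longrightarrow> wval (seg t) f (fst p) < wval (seg t) f (snd p))"
      by eventually_elim simp
    from eventually_happens'[OF trivial_limit_at_right_real this] show ?thesis
      by (auto simp: case_prod_beta)
  qed
  show "w \<in> monomial_free"
    unfolding monomial_free_def
  proof (intro CollectI allI ballI notI)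
    fix d f u assume f: "f \<in> L d" and init: "monomial_init w f u"
    interpret valuated_vectors "E d" "L d" \<kappa> by (rule vectors)
    have fu: "f u \<noteq> Infty" using init unfolding monomial_init_def by blast
    obtain t where t: "t \<in> {0<..<1}"
      "\<And>x y. x \<in> E d \<Longrightarrow> y \<in> E d \<Longrightarrow> wval w f x < wval w f y \<Longrightarrow> wval (seg t) f x < wval (seg t) f y"
      using near[of d f] by auto
    have "is_init \<kappa> (\<lambda>u. seg t \<bullet> exponent u) f u"
      using init t(2) support[OF f] unfolding is_init_def monomial_init_def precedes_def by blast
    then have uM: "(d, u) \<in> ?M" using initial_setI[OF f] seg_M[OF t(1)] by blast
    let ?g0 = "fundamental ?M d u"
    obtain v where v: "v \<noteq> u" "?g0 v \<noteq> Infty" "wval w ?g0 u = wval w ?g0 v"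
      using ties uM by blast
    obtain c where c: "(\<lambda>v. Fin c * ?g0 v) \<in> L d" "Fin c * ?g0 u = f u"
      using rescale[OF fundamental(1,2)[OF uM] fu] by blast
    define g where "g = (\<lambda>v. Fin c * ?g0 v)"
    have g: "g \<in> L d" "g u = f u" "\<And>x. g x = Infty \<longleftrightarrow> ?g0 x = Infty" using c unfolding g_def by auto
    have val: "wval w g x = c + wval w ?g0 x" if "?g0 x \<noteq> Infty" for x
      using that unfolding g_def tval_def by (cases "?g0 x") auto
    have "wval w g v = wval w g u"
      using val[OF v(2)] val[OF fundamental(2)[OF uM]] v(3) by simp
    then have gv: "wval w g v = wval w f u" using g(2) unfolding tval_def by simp
    obtain h where h: "h \<in> L d" "h u = Infty" "\<And>x. min (f x) (g x) \<le> h x"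
      "\<And>x. f x \<noteq> g x \<Longrightarrow> h x = min (f x) (g x)"
      using elim[OF f g(1) g(2)[symmetric] fu] by blast
    \<comment> \<open>The tie puts \<open>v\<close> at the minimal value of \<open>f\<close>, while
      \<open>f\<close> itself is strictly larger there or has no such term; hence \<open>v\<close>
      survives the elimination.\<close>
    have "g v < f v"
    proof (cases "f v")
      case (Fin y)
      then have "wval w f u < wval w f v" using init v(1) unfolding monomial_init_def by auto
      then show ?thesis using gv Fin v(2) g(3)[of v] unfolding tval_def by (cases "g v") auto
    next
      case Infty
      then show ?thesis using v(2) g(3)[of v] by (cases "g v") auto
    qed
    then have hv: "h v = g v" using h(4)[of v] by (auto simp: min_def)
    then have hv_fin: "h v \<noteq> Infty" using g(3) v(2) by auto
    obtain s where s: "s \<in> {0<..<1}"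
      "\<And>x y. x \<in> E d \<Longrightarrow> y \<in> E d \<Longrightarrow> wval w h x < wval w h y \<Longrightarrow> wval (seg s) h x < wval (seg s) h y"
      using near[of d h] by auto
    obtain x where x: "is_init \<kappa> (\<lambda>u. seg s \<bullet> exponent u) h x"
      using is_init_exists[OF h(1) hv_fin] by blast
    then have hx: "h x \<noteq> Infty" and xM: "(d, x) \<in> ?M"
      using initial_setI[OF h(1)] seg_M[OF s(1)] unfolding is_init_def by blast+
    have xu: "x \<noteq> u" using h(2) hx by auto
    \<comment> \<open>On \<open>M\<close> without \<open>u\<close> the vector \<open>g\<close> has
      no terms, so \<open>h\<close> is at least \<open>f\<close> there and lies strictly above the
      value that \<open>h\<close> takes at \<open>v\<close>. Thus \<open>x\<close> cannot be initial
      in \<open>h\<close> near \<open>w\<close>.\<close>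
    have gx: "g x = Infty" using fundamental(3)[OF uM, of x] xM xu g(3) by blast
    have fx: "f x \<le> h x" using h(3)[of x] gx by (simp add: min_def)
    then have fx': "f x \<noteq> Infty" using hx by auto
    have "wval w h v = wval w f u" using gv hv unfolding tval_def by simp
    also have "\<dots> < wval w f x" using init xu fx' unfolding monomial_init_def by blast
    also have "\<dots> \<le> wval w h x"
      using fx fx' hx unfolding tval_def by (cases "f x"; cases "h x") auto
    finally have "wval (seg s) h v < wval (seg s) h x"
      by (rule s(2)[OF support[OF h(1) hv_fin] support[OF h(1) hx]])
    then show False using is_init_le[OF x hv_fin] by simp
  qed
qed

text \<open>By definition the cell lies on one side of the tie hyperplane, which is therefore
  supporting.\<close>

lemma face_of_groebner_cell:
  assumes "(d, u) \<in> initial_set w0" "fundamental (initial_set w0) d u v \<noteq> Infty"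
  shows "(groebner_cell (initial_set w0) \<inter>
    {w. wval w (fundamental (initial_set w0) d u) u = wval w (fundamental (initial_set w0) d u) v})
    face_of groebner_cell (initial_set w0)"
proof -
  let ?f = "fundamental (initial_set w0) d u" and ?C = "groebner_cell (initial_set w0)"
  have eq: "{w. wval w ?f u = wval w ?f v} =
      {w. (exponent u - exponent v) \<bullet> w = real_part (?f v) - real_part (?f u)}"
    by (auto simp: tval_def inner_diff_left inner_diff_right inner_commute algebra_simps)
  show ?thesis
    unfolding eq
  proof (rule face_of_Int_supporting_hyperplane_le)
    show "convex ?C" using polyhedron_groebner_cell polyhedron_imp_convex by blast
    fix w assume "w \<in> ?C"
    then have "w \<in> min_at (initial_set w0) (d, u)" using assms(1) unfolding groebner_cell_def by blast
    then have "wval w ?f u \<le> wval w ?f v" using assms(2) unfolding min_at_def by simp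
    then show "(exponent u - exponent v) \<bullet> w \<le> real_part (?f v) - real_part (?f u)"
      by (simp add: tval_def inner_diff_left inner_diff_right inner_commute algebra_simps)
  qed
qed

text \<open>Inside a cell, membership in \<open>monomial_free\<close> only asks for enough ties, so
  every point sharing all ties of \<open>w\<close> has it too; such points form a face.\<close>

lemma monomial_free_face:
  assumes w: "w \<in> groebner_cell (initial_set w0)" "w \<in> monomial_free"
  obtains F where "F face_of groebner_cell (initial_set w0)" "w \<in> F" "F \<subseteq> monomial_free"
proof -
  let ?M = "initial_set w0" and ?C = "groebner_cell (initial_set w0)"
  let ?T = "\<lambda>d u v. ?C \<inter> {x. wval x (fundamental ?M d u) u = wval x (fundamental ?M d u) v}"
  \<comment> \<open>The family may be infinite, but arbitrary intersections of faces are faces;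
    adding the cell itself makes the family nonempty.\<close>
  define \<F> where "\<F> = insert ?C {?T d u v | d u v. (d, u) \<in> ?M \<and> fundamental ?M d u v \<noteq> Infty \<and> w \<in> ?T d u v}"
  have face: "\<Inter>\<F> face_of ?C"
  proof (rule face_of_Inter)
    fix T assume "T \<in> \<F>"
    then show "T face_of ?C"
      unfolding \<F>_def using face_of_groebner_cell
      by (auto simp: face_of_refl polyhedron_imp_convex[OF polyhedron_groebner_cell])
  qed (auto simp: \<F>_def)
  moreover have "w \<in> \<Inter>\<F>" unfolding \<F>_def using w(1) by auto
  moreover have "\<Inter>\<F> \<subseteq> monomial_free"
  proof
    fix x assume x: "x \<in> \<Inter>\<F>"
    then have xC: "x \<in> ?C" unfolding \<F>_def by blast
    show "x \<in> monomial_free"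
      unfolding monomial_free_in_cell[OF xC]
    proof (intro allI impI)
      fix d u assume du: "(d, u) \<in> ?M"
      then obtain v where v: "v \<noteq> u" "fundamental ?M d u v \<noteq> Infty" "w \<in> ?T d u v"
        using w monomial_free_in_cell[OF w(1)] by blast
      then have "?T d u v \<in> \<F>" using du unfolding \<F>_def by blast
      then have "x \<in> ?T d u v" using x by blast
      then show "\<exists>v. v \<noteq> u \<and> fundamental ?M d u v \<noteq> Infty \<and> wval x (fundamental ?M d u) u = wval x (fundamental ?M d u) v"
        using v by blast
    qed
  qed
  ultimately show ?thesis by (rule that)
qed

theorem monomial_free_polyhedral:
  "\<exists>\<P>. finite \<P> \<and> (\<forall>P\<in>\<P>. polyhedron P) \<and> \<Union>\<P> = monomial_free"
proof -
  define \<P> where "\<P> = (\<Union>M\<in>range initial_set. {F. F face_of groebner_cell M \<and> F \<subseteq> monomial_free})"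
  have "finite {F. F face_of groebner_cell (initial_set w) \<and> F \<subseteq> monomial_free}" for w
    by (rule finite_subset[OF _ finite_polyhedron_faces[OF polyhedron_groebner_cell]]) auto
  then have "finite \<P>"
    unfolding \<P>_def by (intro finite_UN_I finite_initial_sets) auto
  moreover have "\<forall>P\<in>\<P>. polyhedron P"
    unfolding \<P>_def using face_of_polyhedron_polyhedron polyhedron_groebner_cell by blast
  moreover have "\<Union>\<P> = monomial_free"
  proof
    show "monomial_free \<subseteq> \<Union>\<P>"
    proof
      fix w assume "w \<in> monomial_free"
      with initial_set_in_cell obtain F where
        "F face_of groebner_cell (initial_set w)" "w \<in> F" "F \<subseteq> monomial_free"
        by (rule monomial_free_face)
      then show "w \<in> \<Union>\<P>" unfolding \<P>_def by blast
    qed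
  qed (auto simp: \<P>_def)
  ultimately show ?thesis by blast
qed

end

section \<open>Hyperplane arrangements\<close>

text \<open>The closed cell of \<open>x\<close>: every weak inequality from \<open>H\<close> that
  holds at \<open>x\<close> is kept. On a hyperplane through \<open>x\<close> both implications
  apply and force equality.\<close>

definition arrangement_cell :: "('a::euclidean_space \<times> real) set \<Rightarrow> 'a \<Rightarrow> 'a set" where
  "arrangement_cell H x =
     {y. \<forall>(a, b)\<in>H. (a \<bullet> x \<le> b \<longrightarrow> a \<bullet> y \<le> b) \<and> (b \<le> a \<bullet> x \<longrightarrow> b \<le> a \<bullet> y)}"

lemma arrangement_cellD:
  assumes "y \<in> arrangement_cell H x" "(a, b) \<in> H"
  shows "a \<bullet> x \<le> b \<Longrightarrow> a \<bullet> y \<le> b" "b \<le> a \<bullet> x \<Longrightarrow> b \<le> a \<bullet> y"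
  using assms unfolding arrangement_cell_def by auto

lemma arrangement_cell_refl: "x \<in> arrangement_cell H x"
  unfolding arrangement_cell_def by auto

lemma arrangement_cell_trans:
  "y \<in> arrangement_cell H x \<Longrightarrow> arrangement_cell H y \<subseteq> arrangement_cell H x"
  unfolding arrangement_cell_def by blast

lemma arrangement_cell_mono: "H \<subseteq> H' \<Longrightarrow> arrangement_cell H' x \<subseteq> arrangement_cell H x"
  unfolding arrangement_cell_def by blast

lemma polyhedron_arrangement_cell:
  assumes "finite H"
  shows "polyhedron (arrangement_cell H x)"
proof -
  have "arrangement_cell H x = (\<Inter>(a, b)\<in>H.
      (if a \<bullet> x \<le> b then {y. a \<bullet> y \<le> b} else UNIV) \<inter> (if b \<le> a \<bullet> x then {y. b \<le> a \<bullet> y} else UNIV))"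
    unfolding arrangement_cell_def by (auto split: if_splits)
  also have "polyhedron \<dots>"
    using assms by (intro polyhedron_Inter) (auto simp: polyhedron_halfspace_le polyhedron_halfspace_ge)
  finally show ?thesis .
qed

lemma finite_arrangement_cells:
  assumes "finite H"
  shows "finite (range (arrangement_cell H))"
proof -
  have "arrangement_cell H x = (\<lambda>(A, B). {y. (\<forall>(a, b)\<in>A. a \<bullet> y \<le> b) \<and> (\<forall>(a, b)\<in>B. b \<le> a \<bullet> y)})
      ({(a, b). (a, b) \<in> H \<and> a \<bullet> x \<le> b}, {(a, b). (a, b) \<in> H \<and> b \<le> a \<bullet> x})" for x
    unfolding arrangement_cell_def by fastforce
  then have "range (arrangement_cell H) \<subseteq>
      (\<lambda>(A, B). {y. (\<forall>(a, b)\<in>A. a \<bullet> y \<le> b) \<and> (\<forall>(a, b)\<in>B. b \<le> a \<bullet> y)}) ` (Pow H \<times> Pow H)"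
    by (intro image_subsetI) (rule image_eqI, assumption, auto)
  then show ?thesis by (rule finite_subset) (use assms in simp)
qed

text \<open>Hyperplanes through \<open>y\<close> also contain \<open>z\<close>, hence the whole
  line; the remaining inequalities are strict at \<open>y\<close> and survive a small step.\<close>

lemma arrangement_cell_prolong:
  assumes "finite H" and y: "y \<in> arrangement_cell H x" and z: "z \<in> arrangement_cell H y"
  obtains e where "0 < e" "y - e *\<^sub>R (z - y) \<in> arrangement_cell H x"
proof -
  have "\<forall>\<^sub>F e in at_right 0. \<forall>h\<in>H. (fst h \<bullet> x \<le> snd h \<longrightarrow> fst h \<bullet> (y - e *\<^sub>R (z - y)) \<le> snd h) \<and>
      (snd h \<le> fst h \<bullet> x \<longrightarrow> snd h \<le> fst h \<bullet> (y - e *\<^sub>R (z - y)))"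
  proof (intro eventually_ball_finite ballI assms)
    fix h assume h: "h \<in> H"
    obtain a b where ab: "h = (a, b)" by (cases h)
    note y' = arrangement_cellD[OF y h[unfolded ab]] and z' = arrangement_cellD[OF z h[unfolded ab]]
    have lim: "((\<lambda>e. a \<bullet> (y - e *\<^sub>R (z - y))) \<longlongrightarrow> a \<bullet> (y - 0 *\<^sub>R (z - y))) (at_right 0)"
      by (intro tendsto_intros)
    consider "a \<bullet> y = b" | "a \<bullet> y < b" | "a \<bullet> y > b" by linarith
    then have "\<forall>\<^sub>F e in at_right 0. (a \<bullet> x \<le> b \<longrightarrow> a \<bullet> (y - e *\<^sub>R (z - y)) \<le> b) \<and>
      (b \<le> a \<bullet> x \<longrightarrow> b \<le> a \<bullet> (y - e *\<^sub>R (z - y)))"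
    proof cases
      case 1
      then have "a \<bullet> z = b" using z' by simp
      then show ?thesis using 1 by (simp add: inner_diff_right)
    next
      case 2
      then have "\<forall>\<^sub>F e in at_right 0. a \<bullet> (y - e *\<^sub>R (z - y)) < b"
        using order_tendstoD(2)[OF lim] by simp
      then show ?thesis using y' 2 by (auto elim: eventually_mono)
    next
      case 3
      then have "\<forall>\<^sub>F e in at_right 0. b < a \<bullet> (y - e *\<^sub>R (z - y))"
        using order_tendstoD(1)[OF lim] by simp
      then show ?thesis using y' 3 by (auto elim: eventually_mono)
    qed
    then show "\<forall>\<^sub>F e in at_right 0. (fst h \<bullet> x \<le> snd h \<longrightarrow> fst h \<bullet> (y - e *\<^sub>R (z - y)) \<le> snd h) \<and>
      (snd h \<le> fst h \<bullet> x \<longrightarrow> snd h \<le> fst h \<bullet> (y - e *\<^sub>R (z - y)))"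
      by (simp add: ab)
  qed
  with eventually_at_right_less[of "0::real"]
  have "\<forall>\<^sub>F e in at_right 0. 0 < e \<and> y - e *\<^sub>R (z - y) \<in> arrangement_cell H x"
    by eventually_elim (auto simp: arrangement_cell_def case_prod_beta)
  from eventually_happens'[OF trivial_limit_at_right_real this] show ?thesis using that by blast
qed

text \<open>Take \<open>y\<close> in the relative interior of \<open>F\<close>. A point
  \<open>z\<close> of the cell of \<open>y\<close> can be prolonged through \<open>y\<close> inside
  the large cell, so the face property puts it into \<open>F\<close>. Conversely, segments from
  points of \<open>F\<close> can be prolonged through \<open>y\<close> inside
  \<open>F\<close>.\<close>

lemma face_of_arrangement_cell:
  assumes "finite H" "F face_of arrangement_cell H x" "F \<noteq> {}"
  obtains y where "y \<in> F" "F = arrangement_cell H y"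
proof -
  have conv: "convex F" using assms(2) face_of_imp_convex by blast
  have sub: "F \<subseteq> arrangement_cell H x" using assms(2) face_of_imp_subset by blast
  obtain y where y: "y \<in> rel_interior F" using conv assms(3) rel_interior_eq_empty by blast
  then have yF: "y \<in> F" using rel_interior_subset by blast
  have "arrangement_cell H y \<subseteq> F"
  proof
    fix z assume z: "z \<in> arrangement_cell H y"
    show "z \<in> F"
    proof (cases "z = y")
      case False
      obtain e where e: "0 < e" "y - e *\<^sub>R (z - y) \<in> arrangement_cell H x"
        using arrangement_cell_prolong[OF assms(1) subsetD[OF sub yF] z] by blast
      define p where "p = y - e *\<^sub>R (z - y)"
      \<comment> \<open>This solves \<open>p = y - e *\<^sub>R (z - y)\<close> for
        \<open>y\<close>.\<close>
      have "y = (1 - 1 / (1 + e)) *\<^sub>R z + (1 / (1 + e)) *\<^sub>R p"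
      proof -
        have *: "(e + e * e) / (1 + e) = e" using e(1) by (simp add: field_simps)
        have "(1 + e) *\<^sub>R y = (1 + e) *\<^sub>R ((1 - 1 / (1 + e)) *\<^sub>R z + (1 / (1 + e)) *\<^sub>R p)"
          using e(1) by (simp add: scaleR_add_right p_def algebra_simps *)
        then show ?thesis using e(1) by simp
      qed
      moreover have "z \<noteq> p"
      proof
        assume "z = p"
        then have "(1 + e) *\<^sub>R (z - y) = 0" unfolding p_def by (simp add: algebra_simps)
        then show False using e(1) False by simp
      qed
      ultimately have "y \<in> open_segment z p"
        unfolding in_segment(2) using e(1) by (intro conjI exI[of _ "1 / (1 + e)"]) auto
      moreover have "z \<in> arrangement_cell H x" using arrangement_cell_trans sub yF z by blast
      ultimately show ?thesis
        using assms(2) e(2) yF unfolding face_of_def p_def by blast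
    qed (use yF in simp)
  qed
  moreover have "F \<subseteq> arrangement_cell H y"
  proof
    fix z assume z: "z \<in> F"
    obtain e where e: "e > 1" "(1 - e) *\<^sub>R z + e *\<^sub>R y \<in> F"
      using y z convex_rel_interior_iff[OF conv assms(3)] by blast
    show "z \<in> arrangement_cell H y"
      unfolding arrangement_cell_def
    proof (intro CollectI ballI, clarify)
      fix a b assume h: "(a, b) \<in> H"
      let ?p = "(1 - e) *\<^sub>R z + e *\<^sub>R y"
      note y' = arrangement_cellD[OF subsetD[OF sub yF] h]
        and z' = arrangement_cellD[OF subsetD[OF sub z] h]
        and p' = arrangement_cellD[OF subsetD[OF sub e(2)] h]
      \<comment> \<open>If the hyperplane passes through \<open>y\<close> but not through
        \<open>z\<close>, then \<open>z\<close> and \<open>?p\<close> lie strictly on opposite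
        sides, although the large cell lies on one side.\<close>
      have p: "a \<bullet> ?p - b = e * (a \<bullet> y - b) - (e - 1) * (a \<bullet> z - b)"
        by (simp add: inner_add_right algebra_simps)
      have "a \<bullet> z \<le> b" if "a \<bullet> y \<le> b"
      proof (rule ccontr)
        assume "\<not> a \<bullet> z \<le> b"
        then have az: "a \<bullet> z > b" "b < a \<bullet> x" using z' by linarith+
        then have "a \<bullet> ?p \<ge> b" "a \<bullet> y = b" using p' y' that by linarith+
        moreover have "(e - 1) * (a \<bullet> z - b) > 0" using az e(1) by simp
        ultimately show False using p by simp
      qed
      moreover have "b \<le> a \<bullet> z" if "b \<le> a \<bullet> y"
      proof (rule ccontr)
        assume "\<not> b \<le> a \<bullet> z"
        then have az: "a \<bullet> z < b" "a \<bullet> x < b" using z' by linarith+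
        then have "a \<bullet> ?p \<le> b" "a \<bullet> y = b" using p' y' that by linarith+
        moreover have "(e - 1) * (a \<bullet> z - b) < 0" using az e(1) by (simp add: mult_pos_neg)
        ultimately show False using p by simp
      qed
      ultimately show "(a \<bullet> y \<le> b \<longrightarrow> a \<bullet> z \<le> b) \<and> (b \<le> a \<bullet> y \<longrightarrow> b \<le> a \<bullet> z)" by blast
    qed
  qed
  ultimately show ?thesis using that yF by blast
qed

text \<open>Where \<open>x\<close> and \<open>y\<close> prescribe the same side there is nothing to
  show. Where they prescribe opposite sides, \<open>p\<close> lies on the hyperplane, and its
  neighbours \<open>u\<close> and \<open>v\<close>, both on the side of \<open>x\<close>, must then
  lie on it as well.\<close>

lemma arrangement_cells_Int_face:
  assumes "finite H"
  shows "arrangement_cell H x \<inter> arrangement_cell H y face_of arrangement_cell H x"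
  unfolding face_of_def
proof (intro conjI ballI impI)
  show "convex (arrangement_cell H x \<inter> arrangement_cell H y)"
    using polyhedron_arrangement_cell[OF assms] by (simp add: convex_Int polyhedron_imp_convex)
  fix u v p assume uv: "u \<in> arrangement_cell H x" "v \<in> arrangement_cell H x"
    and p: "p \<in> arrangement_cell H x \<inter> arrangement_cell H y" "p \<in> open_segment u v"
  obtain t where t: "0 < t" "t < 1" "p = (1 - t) *\<^sub>R u + t *\<^sub>R v"
    using p(2) unfolding in_segment(2) by blast
  have "u \<in> arrangement_cell H y \<and> v \<in> arrangement_cell H y"
    unfolding arrangement_cell_def mem_Collect_eq ball_conj_distrib[symmetric]
  proof (clarify)
    fix a b assume h: "(a, b) \<in> H"
    note u' = arrangement_cellD[OF uv(1) h] and v' = arrangement_cellD[OF uv(2) h]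
      and p' = arrangement_cellD[OF IntD2[OF p(1)] h]
    have eq: "a \<bullet> p - b = (1 - t) * (a \<bullet> u - b) + t * (a \<bullet> v - b)"
      unfolding t(3) by (simp add: inner_add_right algebra_simps)
    have "a \<bullet> u \<le> b \<and> a \<bullet> v \<le> b" if "a \<bullet> y \<le> b"
    proof (cases "a \<bullet> x \<le> b")
      case False
      then have "a \<bullet> u - b \<ge> 0" "a \<bullet> v - b \<ge> 0" "a \<bullet> p - b \<le> 0" using u' v' p' that by simp_all
      moreover from this have "(1 - t) * (a \<bullet> u - b) \<ge> 0" "t * (a \<bullet> v - b) \<ge> 0" using t by simp_all
      ultimately have "(1 - t) * (a \<bullet> u - b) = 0" "t * (a \<bullet> v - b) = 0" using eq by linarith+
      then show ?thesis using t by simp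
    qed (use u' v' in blast)
    moreover have "b \<le> a \<bullet> u \<and> b \<le> a \<bullet> v" if "b \<le> a \<bullet> y"
    proof (cases "b \<le> a \<bullet> x")
      case False
      then have "a \<bullet> u - b \<le> 0" "a \<bullet> v - b \<le> 0" "a \<bullet> p - b \<ge> 0" using u' v' p' that by simp_all
      moreover from this have "(1 - t) * (a \<bullet> u - b) \<le> 0" "t * (a \<bullet> v - b) \<le> 0"
        using t by (simp_all add: mult_nonneg_nonpos)
      ultimately have "(1 - t) * (a \<bullet> u - b) = 0" "t * (a \<bullet> v - b) = 0" using eq by linarith+
      then show ?thesis using t by simp
    qed (use u' v' in blast)
    ultimately show "((a \<bullet> y \<le> b \<longrightarrow> a \<bullet> u \<le> b) \<and> (b \<le> a \<bullet> y \<longrightarrow> b \<le> a \<bullet> u)) \<and>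
      ((a \<bullet> y \<le> b \<longrightarrow> a \<bullet> v \<le> b) \<and> (b \<le> a \<bullet> y \<longrightarrow> b \<le> a \<bullet> v))" by blast
  qed
  then show "u \<in> arrangement_cell H x \<inter> arrangement_cell H y"
    "v \<in> arrangement_cell H x \<inter> arrangement_cell H y" using uv by blast+
qed auto

text \<open>The empty set is a face of every cell but not a cell itself, since each cell contains
  its base point; therefore it is inserted.\<close>

lemma polyhedral_complex_arrangement_cells:
  assumes "finite H" and closed: "\<And>x. x \<in> X \<Longrightarrow> arrangement_cell H x \<subseteq> X"
  shows "polyhedral_complex (insert {} (arrangement_cell H ` X))"
  unfolding polyhedral_complex_def
proof (intro conjI ballI allI impI)
  let ?C = "insert {} (arrangement_cell H ` X)"
  show "polyhedron P" if "P \<in> ?C" for P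
    using that polyhedron_arrangement_cell[OF assms(1)] by auto
  show "F \<in> ?C" if PF: "P \<in> ?C" "F face_of P" for P F
  proof (cases "F = {}")
    case False
    then obtain x where x: "x \<in> X" "P = arrangement_cell H x" using PF by auto
    then obtain y where "y \<in> F" "F = arrangement_cell H y"
      using face_of_arrangement_cell[OF assms(1)] PF(2) False by blast
    then show ?thesis using closed[OF x(1)] face_of_imp_subset[OF PF(2)] x(2) by blast
  qed simp
  fix P Q assume PQ: "P \<in> ?C" "Q \<in> ?C"
  have face: "S \<inter> T face_of S" if "S \<in> ?C" "T \<in> ?C" for S T
    using that arrangement_cells_Int_face[OF assms(1)] by auto
  show "P \<inter> Q face_of P" by (rule face[OF PQ])
  show "P \<inter> Q face_of Q" using face[OF PQ(2,1)] by (simp add: Int_commute)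
qed

text \<open>Collecting the halfspaces that define the polyhedra suffices: a cell keeps every weak
  inequality satisfied by its base point.\<close>

lemma polyhedra_arrangement:
  assumes "finite \<P>" "\<And>P. P \<in> \<P> \<Longrightarrow> polyhedron P"
  obtains H where "finite H" "\<And>x. x \<in> \<Union>\<P> \<Longrightarrow> arrangement_cell H x \<subseteq> \<Union>\<P>"
proof -
  have "\<exists>H. finite H \<and> (\<forall>x\<in>P. arrangement_cell H x \<subseteq> P)" if P: "polyhedron P" for P :: "'a set"
  proof -
    obtain F where F: "finite F" "P = \<Inter>F" "\<forall>h\<in>F. \<exists>a b. a \<noteq> 0 \<and> h = {x. a \<bullet> x \<le> b}"
      using P unfolding polyhedron_def by blast
    then obtain a b where ab: "\<And>h. h \<in> F \<Longrightarrow> h = {x. a h \<bullet> x \<le> b h}" by metis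
    have "arrangement_cell ((\<lambda>h. (a h, b h)) ` F) x \<subseteq> P" if "x \<in> P" for x
    proof
      fix y assume y: "y \<in> arrangement_cell ((\<lambda>h. (a h, b h)) ` F) x"
      have "y \<in> h" if h: "h \<in> F" for h
      proof -
        have "x \<in> h" using \<open>x \<in> P\<close> F(2) h by blast
        then have "a h \<bullet> x \<le> b h" using ab[OF h] by blast
        then have "a h \<bullet> y \<le> b h" using arrangement_cellD(1)[OF y] h by blast
        then show ?thesis using ab[OF h] by blast
      qed
      then show "y \<in> P" using F(2) by blast
    qed
    then show ?thesis using F(1) by blast
  qed
  then obtain K where K: "\<And>P. P \<in> \<P> \<Longrightarrow> finite (K P)"
    "\<And>P x. P \<in> \<P> \<Longrightarrow> x \<in> P \<Longrightarrow> arrangement_cell (K P) x \<subseteq> P"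
    using assms(2) by metis
  have "arrangement_cell (\<Union>(K ` \<P>)) x \<subseteq> \<Union>\<P>" if x: "x \<in> \<Union>\<P>" for x
  proof -
    obtain P where P: "P \<in> \<P>" "x \<in> P" using x by blast
    have "arrangement_cell (\<Union>(K ` \<P>)) x \<subseteq> arrangement_cell (K P) x"
      by (rule arrangement_cell_mono) (use P in blast)
    then show ?thesis using K(2)[OF P] P(1) by blast
  qed
  then show ?thesis using that[of "\<Union>(K ` \<P>)"] assms(1) K(1) by blast
qed

section \<open>Varieties and closures in strata\<close>

lemma trop_sum_le: "finite A \<Longrightarrow> u \<in> A \<Longrightarrow> (\<Sum>x\<in>A. g x) \<le> (g u :: trop)"
  by (induction A rule: finite_induct) (auto simp: plus_trop_def min_le_iff_disj)

lemma trop_sum_attained: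
  "finite A \<Longrightarrow> (\<Sum>x\<in>A. g x) = (Infty :: trop) \<or> (\<exists>u\<in>A. g u = (\<Sum>x\<in>A. g x))"
  by (induction A rule: finite_induct) (auto simp: plus_trop_def zero_trop_def min_def)

lemma trop_power: "Fin a ^ k = Fin (real k * a)" "Infty ^ k = (if k = 0 then Fin 0 else Infty)"
  by (induction k) (auto simp: one_trop_def algebra_simps)

lemma trop_prod_Fin: "finite A \<Longrightarrow> (\<Prod>i\<in>A. Fin (g i)) = Fin (\<Sum>i\<in>A. g i)"
  by (induction A rule: finite_induct) (auto simp: one_trop_def)

lemma trop_prod_Infty: "finite A \<Longrightarrow> i \<in> A \<Longrightarrow> g i = Infty \<Longrightarrow> (\<Prod>i\<in>A. g i) = (Infty :: trop)"
  by (induction A rule: finite_induct) auto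

lemma stratum_Infty_iff: "w \<in> stratum \<sigma> \<Longrightarrow> w $ i = Infty \<longleftrightarrow> i \<in> \<sigma>"
  unfolding stratum_def by blast

definition avoids :: "'n::finite set \<Rightarrow> ('n \<Rightarrow>\<^sub>0 nat) \<Rightarrow> bool" where
  "avoids \<sigma> u \<longleftrightarrow> (\<forall>i\<in>\<sigma>. Poly_Mapping.lookup u i = 0)"

text \<open>The coefficients of the polynomial obtained by setting the variables in \<open>\<sigma>\<close> to \<open>\<infinity>\<close>.\<close>

definition restrict_coeff :: "'n::finite set \<Rightarrow> 'n trop_poly \<Rightarrow> ('n \<Rightarrow>\<^sub>0 nat) \<Rightarrow> trop" where
  "restrict_coeff \<sigma> f u = (if avoids \<sigma> u then Poly_Mapping.lookup f u else Infty)"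

lemma keys_trop: "u \<in> Poly_Mapping.keys f \<longleftrightarrow> Poly_Mapping.lookup f u \<noteq> Infty"
  by (simp add: in_keys_iff zero_trop_def)

lemma term_value_stratum:
  assumes "w \<in> stratum \<sigma>"
  shows "term_value f u w =
    (if restrict_coeff \<sigma> f u = Infty then Infty else Fin (wval (chart w) (restrict_coeff \<sigma> f) u))"
proof (cases "avoids \<sigma> u")
  case True
  have "w $ i ^ Poly_Mapping.lookup u i = Fin (chart w $ i * exponent u $ i)" for i
  proof (cases "i \<in> \<sigma>")
    case i: True
    then have "w $ i = Infty" using assms unfolding stratum_def by blast
    \<comment> \<open>Here the exponent is 0, and \<open>Infty ^ 0 = Fin 0\<close>, in agreement
      with the chart coordinate 0.\<close>
    then show ?thesis using True i by (auto simp: avoids_def exponent_def one_trop_def)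
  next
    case False
    then have "w $ i \<noteq> Infty" using assms unfolding stratum_def by blast
    then show ?thesis by (cases "w $ i") (auto simp: trop_power exponent_def chart_def)
  qed
  then have "(\<Prod>i\<in>UNIV. w $ i ^ Poly_Mapping.lookup u i) = Fin (chart w \<bullet> exponent u)"
    by (simp add: trop_prod_Fin inner_vec_def)
  then show ?thesis
    using True unfolding term_value_def tval_def restrict_coeff_def
    by (cases "Poly_Mapping.lookup f u") auto
next
  case False
  then obtain i where i: "i \<in> \<sigma>" "Poly_Mapping.lookup u i \<noteq> 0" unfolding avoids_def by blast
  then have "w $ i ^ Poly_Mapping.lookup u i = Infty"
    using stratum_Infty_iff[OF assms, of i] by (simp add: trop_power)
  then have "(\<Prod>i\<in>UNIV. w $ i ^ Poly_Mapping.lookup u i) = Infty"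
    by (intro trop_prod_Infty[of _ i]) auto
  then show ?thesis using False unfolding term_value_def restrict_coeff_def by simp
qed

text \<open>Only terms avoiding \<sigma> are finite at \<open>w\<close>. If there are none, both
  sides hold: the value is \<open>Infty\<close> and no term can be a strict minimum.\<close>

lemma variety_stratum:
  assumes w: "w \<in> stratum \<sigma>"
  shows "w \<in> variety f \<longleftrightarrow> \<not> (\<exists>u. monomial_init (chart w) (restrict_coeff \<sigma> f) u)"
proof
  let ?r = "restrict_coeff \<sigma> f" and ?w = "chart w"
  note val = term_value_stratum[OF w, of f]
  have key: "u \<in> Poly_Mapping.keys f" if "?r u \<noteq> Infty" for u
    using that unfolding keys_trop restrict_coeff_def by (auto split: if_splits)
  have le: "poly_value f w \<le> term_value f u w" if "u \<in> Poly_Mapping.keys f" for u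
    unfolding poly_value_def using that by (intro trop_sum_le) auto
  {
    assume V: "w \<in> variety f"
    show "\<not> (\<exists>u. monomial_init ?w ?r u)"
    proof
      assume "\<exists>u. monomial_init ?w ?r u"
      then obtain u where u: "?r u \<noteq> Infty"
        "\<And>v. v \<noteq> u \<Longrightarrow> ?r v \<noteq> Infty \<Longrightarrow> wval ?w ?r u < wval ?w ?r v"
        unfolding monomial_init_def by blast
      have pv: "poly_value f w \<le> term_value f u w" "term_value f u w \<noteq> Infty"
        using le[OF key[OF u(1)]] u(1) val by auto
      then have "poly_value f w \<noteq> Infty" by auto
      then obtain u1 u2 where "u1 \<noteq> u2" "term_value f u1 w = poly_value f w" "term_value f u2 w = poly_value f w"
        using V unfolding variety_def by blast
      then obtain v where v: "v \<noteq> u" "term_value f v w = poly_value f w" by metis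
      then have rv: "?r v \<noteq> Infty" using \<open>poly_value f w \<noteq> Infty\<close> val by metis
      have "term_value f v w \<le> term_value f u w" using v(2) pv(1) by simp
      then show False using u(1) u(2)[OF v(1) rv] rv val by simp
    qed
  }
  {
    assume no: "\<not> (\<exists>u. monomial_init ?w ?r u)"
    show "w \<in> variety f"
    proof (rule ccontr)
      assume nV: "w \<notin> variety f"
      then have "poly_value f w \<noteq> Infty" unfolding variety_def by blast
      then obtain u where u: "u \<in> Poly_Mapping.keys f" "term_value f u w = poly_value f w"
        using trop_sum_attained[of "Poly_Mapping.keys f" "\<lambda>u. term_value f u w"]
        unfolding poly_value_def by auto
      then have ru: "?r u \<noteq> Infty" using \<open>poly_value f w \<noteq> Infty\<close> val by metis
      have "wval ?w ?r u < wval ?w ?r v" if v: "v \<noteq> u" "?r v \<noteq> Infty" for v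
      proof -
        have "term_value f v w \<noteq> poly_value f w"
          using nV u v(1) key[OF v(2)] unfolding variety_def by blast
        then have "term_value f u w < term_value f v w" using le[OF key[OF v(2)]] u(2) by simp
        then show ?thesis using ru v(2) val by simp
      qed
      then show False using no ru unfolding monomial_init_def by blast
    qed
  }
qed

section \<open>Neighbourhoods in \<open>trop\<close> and limits between strata\<close>

lemma open_trop_FinD:
  assumes "open U" "Fin a \<in> U"
  shows "\<exists>e>0. \<forall>x. \<bar>x - a\<bar> < e \<longrightarrow> Fin x \<in> U"
  using assms unfolding open_trop_def
proof (induction U rule: generate_topology.induct)
  case (Int S T)
  then obtain e1 e2 where e: "e1 > 0" "\<forall>x. \<bar>x - a\<bar> < e1 \<longrightarrow> Fin x \<in> S"
    "e2 > 0" "\<forall>x. \<bar>x - a\<bar> < e2 \<longrightarrow> Fin x \<in> T" by blast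
  then show ?case by (intro exI[of _ "min e1 e2"]) auto
next
  case (Basis S)
  then consider c d where "S = Fin ` {c<..<d}" | c where "S = insert Infty (Fin ` {c<..})" by blast
  then show ?case
  proof cases
    case 1
    show ?thesis using Basis(2) unfolding 1 by (intro exI[of _ "min (a - c) (d - a)"]) (auto intro!: imageI simp: abs_less_iff)
  next
    case 2
    show ?thesis using Basis(2) unfolding 2 by (intro exI[of _ "a - c"]) auto
  qed
next
  case UNIV
  show ?case by (intro exI[of _ 1]) simp
next
  case (UN K)
  then obtain S where S: "S \<in> K" "Fin a \<in> S" by auto
  then obtain e where "e > 0" "\<forall>x. \<bar>x - a\<bar> < e \<longrightarrow> Fin x \<in> S" using UN.IH by meson
  then show ?case using S(1) by (intro exI[of _ e]) auto
qed

lemma open_trop_InftyD: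
  assumes "open U" "Infty \<in> U"
  shows "\<exists>R. \<forall>x>R. Fin x \<in> U"
  using assms unfolding open_trop_def
proof (induction U rule: generate_topology.induct)
  case (Int S T)
  then obtain r1 r2 where "\<forall>x>r1. Fin x \<in> S" "\<forall>x>r2. Fin x \<in> T" by blast
  then show ?case by (intro exI[of _ "max r1 r2"]) auto
next
  case (Basis S)
  then consider c d where "S = Fin ` {c<..<d}" | c where "S = insert Infty (Fin ` {c<..})" by blast
  then show ?case using Basis by cases auto
next
  case (UN K)
  then obtain S where S: "S \<in> K" "Infty \<in> S" by auto
  then obtain R where "\<forall>x>R. Fin x \<in> S" using UN.IH by meson
  then show ?case using S(1) by (intro exI[of _ R]) auto
qed simp

lemma open_trop_basis: "open (Fin ` {a<..<b})" "open (insert Infty (Fin ` {a<..}))"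
  unfolding open_trop_def by (rule generate_topology.Basis; blast)+

text \<open>Coordinates in \<open>\<tau>\<close> are \<open>\<infinity>\<close> along the whole sequence, hence carry no condition.\<close>

definition tends_to_stratum ::
    "(nat \<Rightarrow> trop ^ 'n::finite) \<Rightarrow> 'n set \<Rightarrow> trop ^ 'n \<Rightarrow> 'n set \<Rightarrow> bool" where
  "tends_to_stratum p \<tau> w \<sigma> \<longleftrightarrow>
     (\<forall>i. i \<notin> \<sigma> \<longrightarrow> (\<lambda>k. chart (p k) $ i) \<longlonglongrightarrow> chart w $ i) \<and>
     (\<forall>i\<in>\<sigma> - \<tau>. filterlim (\<lambda>k. chart (p k) $ i) at_top sequentially)"

lemma closure_stratum_sequence:
  assumes w: "w \<in> closure P" "w \<in> stratum \<sigma>" and P: "P \<subseteq> stratum \<tau>"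
  obtains p where "\<And>k. p k \<in> P" "tends_to_stratum p \<tau> w \<sigma>"
proof -
  have winf: "w $ i = Infty \<longleftrightarrow> i \<in> \<sigma>" for i using w(2) unfolding stratum_def by blast
  \<comment> \<open>A sequence of boxes around \<open>w\<close>: shrinking intervals at finite
    coordinates, neighbourhoods of \<open>Infty\<close> with growing bounds at the others.\<close>
  define B where "B k i = (if i \<in> \<sigma> then insert Infty (Fin ` {real k<..})
      else Fin ` {chart w $ i - inverse (real (Suc k)) <..< chart w $ i + inverse (real (Suc k))})" for k i
  have "\<exists>q\<in>P. \<forall>i. q $ i \<in> B k i" for k
  proof -
    have "open {q. \<forall>i. q $ i \<in> B k i}"
      by (rule open_vector_box) (auto simp: B_def open_trop_basis)
    moreover have "w $ i \<in> B k i" for i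
    proof (cases "w $ i")
      case (Fin a)
      then show ?thesis using winf[of i] by (auto simp: B_def chart_def)
    next
      case Infty
      then show ?thesis using winf[of i] by (auto simp: B_def)
    qed
    ultimately have "P \<inter> {q. \<forall>i. q $ i \<in> B k i} \<noteq> {}"
      using w(1) open_Int_closure_eq_empty[of "{q. \<forall>i. q $ i \<in> B k i}" P] by blast
    then show ?thesis by blast
  qed
  then obtain p where p: "\<And>k. p k \<in> P" "\<And>k i. p k $ i \<in> B k i" by metis
  have "(\<lambda>k. chart (p k) $ i) \<longlonglongrightarrow> chart w $ i" if i: "i \<notin> \<sigma>" for i
  proof (rule LIM_zero_cancel, rule LIMSEQ_norm_0)
    show "norm (chart (p k) $ i - chart w $ i) < 1 / real (Suc k)" for k
      using p(2)[of k i] i by (auto simp: B_def chart_def inverse_eq_divide)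
  qed
  moreover have "filterlim (\<lambda>k. chart (p k) $ i) at_top sequentially" if i: "i \<in> \<sigma> - \<tau>" for i
  proof (rule filterlim_at_top_mono[OF filterlim_real_sequentially], rule always_eventually, rule allI)
    fix k
    have "p k $ i \<noteq> Infty" using p(1)[of k] P i unfolding stratum_def by blast
    then show "real k \<le> chart (p k) $ i"
      using p(2)[of k i] i by (auto simp: B_def chart_def)
  qed
  ultimately show ?thesis using that[of p] p(1) unfolding tends_to_stratum_def by blast
qed

lemma closure_stratum_of_sequence:
  assumes p: "\<And>k. p k \<in> P" "tends_to_stratum p \<tau> w \<sigma>"
    and w: "w \<in> stratum \<sigma>" and P: "P \<subseteq> stratum \<tau>" and sub: "\<tau> \<subseteq> \<sigma>"
  shows "w \<in> closure P"
proof (rule ccontr)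
  assume "w \<notin> closure P"
  then have "open (- closure P)" "w \<in> - closure P" by auto
  then obtain A where A: "\<And>i. open (A i)" "\<And>i. w $ i \<in> A i"
    "\<And>y. (\<And>i. y $ i \<in> A i) \<Longrightarrow> y \<in> - closure P"
    unfolding open_vec_def by metis
  have winf: "w $ i = Infty \<longleftrightarrow> i \<in> \<sigma>" for i using w unfolding stratum_def by blast
  have pinf: "p k $ i = Infty \<longleftrightarrow> i \<in> \<tau>" for k i using p(1)[of k] P unfolding stratum_def by blast
  have pfin: "p k $ i = Fin (chart (p k) $ i)" if "i \<notin> \<tau>" for k i
    using pinf[of k i] that by (cases "p k $ i") (auto simp: chart_def)
  have "\<forall>\<^sub>F k in sequentially. p k $ i \<in> A i" for i
  proof -
    consider "i \<in> \<tau>" | "i \<in> \<sigma> - \<tau>" | "i \<notin> \<sigma>" by blast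
    then show ?thesis
    proof cases
      case 1
      then have "p k $ i = w $ i" for k using pinf[of k i] winf[of i] sub by auto
      then show ?thesis using A(2) by simp
    next
      case 2
      have "Infty \<in> A i" using A(2)[of i] winf[of i] 2 by simp
      then obtain R where R: "\<And>x. x > R \<Longrightarrow> Fin x \<in> A i"
        using open_trop_InftyD[OF A(1)[of i]] by blast
      have "\<forall>\<^sub>F k in sequentially. R < chart (p k) $ i"
        using p(2) 2 unfolding tends_to_stratum_def filterlim_at_top_dense by blast
      then show ?thesis by eventually_elim (use R pfin 2 in auto)
    next
      case 3
      then have "w $ i = Fin (chart w $ i)" using winf[of i] by (cases "w $ i") (auto simp: chart_def)
      then obtain e where e: "e > 0" "\<And>x. \<bar>x - chart w $ i\<bar> < e \<Longrightarrow> Fin x \<in> A i"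
        using open_trop_FinD[OF A(1)[of i]] A(2)[of i] by metis
      have "\<forall>\<^sub>F k in sequentially. dist (chart (p k) $ i) (chart w $ i) < e"
        using p(2) 3 e(1) unfolding tends_to_stratum_def by (intro tendstoD) auto
      moreover have "i \<notin> \<tau>" using 3 sub by blast
      ultimately show ?thesis
        by (elim eventually_mono) (simp add: pfin e(2) dist_real_def)
    qed
  qed
  then have "\<forall>\<^sub>F k in sequentially. \<forall>i. p k $ i \<in> A i" by (simp add: eventually_all_finite)
  then obtain k where "\<And>i. p k $ i \<in> A i"
    using eventually_happens'[OF sequentially_bot] by blast
  then have "p k \<in> - closure P" by (rule A(3))
  then show False using p(1)[of k] closure_subset by blast
qed

text \<open>Along the sequence, values of terms that avoid \<sigma> converge, while those of terms
  that avoid \<tau> but not \<sigma> tend to infinity, so a strict minimum in the limit is already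
  one for some \<open>k\<close>.\<close>

lemma monomial_init_near_stratum:
  assumes lim: "tends_to_stratum p \<tau> w \<sigma>" and p: "\<And>k. p k \<in> stratum \<tau>" and sub: "\<tau> \<subseteq> \<sigma>"
    and init: "monomial_init (chart w) (restrict_coeff \<sigma> f) u"
  shows "\<exists>k. monomial_init (chart (p k)) (restrict_coeff \<tau> f) u"
proof -
  have lim_fin: "(\<lambda>k. \<Sum>i\<in>-\<sigma>. chart (p k) $ i * exponent v $ i) \<longlonglongrightarrow> (\<Sum>i\<in>-\<sigma>. chart w $ i * exponent v $ i)" for v
    using lim unfolding tends_to_stratum_def by (intro tendsto_sum tendsto_mult tendsto_const) auto
  have split: "x \<bullet> exponent v = (\<Sum>i\<in>-\<sigma>. x $ i * exponent v $ i) + (\<Sum>i\<in>\<sigma>. x $ i * exponent v $ i)"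
    for x v
  proof -
    have "x \<bullet> exponent v = (\<Sum>i\<in>-\<sigma> \<union> \<sigma>. x $ i * exponent v $ i)" by (simp add: inner_vec_def)
    also have "\<dots> = (\<Sum>i\<in>-\<sigma>. x $ i * exponent v $ i) + (\<Sum>i\<in>\<sigma>. x $ i * exponent v $ i)"
      by (rule sum.union_disjoint) auto
    finally show ?thesis .
  qed
  have off: "x \<bullet> exponent v = (\<Sum>i\<in>-\<sigma>. x $ i * exponent v $ i)" if "avoids \<sigma> v" for x v
    using that unfolding split by (simp add: avoids_def exponent_def)
  have avoid_sub: "avoids \<tau> v" if "avoids \<sigma> v" for v :: "'a \<Rightarrow>\<^sub>0 nat"
    using that sub unfolding avoids_def by blast
  have conv: "(\<lambda>k. wval (chart (p k)) (restrict_coeff \<tau> f) v) \<longlonglongrightarrow> wval (chart w) (restrict_coeff \<sigma> f) v"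
    if "avoids \<sigma> v" for v
    using that avoid_sub unfolding tval_def off[OF that] restrict_coeff_def
    by (auto intro!: tendsto_intros lim_fin)
  have diverge: "filterlim (\<lambda>k. wval (chart (p k)) (restrict_coeff \<tau> f) v) at_top sequentially"
    if v: "avoids \<tau> v" "\<not> avoids \<sigma> v" for v
  proof -
    obtain j where j: "j \<in> \<sigma>" "Poly_Mapping.lookup v j \<noteq> 0" using v unfolding avoids_def by blast
    then have j': "j \<in> \<sigma> - \<tau>" using v(1) unfolding avoids_def by auto
    have pos: "\<forall>\<^sub>F k in sequentially. \<forall>i\<in>\<sigma> - \<tau>. 0 \<le> chart (p k) $ i"
    proof (intro eventually_ball_finite ballI)
      fix i assume "i \<in> \<sigma> - \<tau>"
      then show "\<forall>\<^sub>F k in sequentially. 0 \<le> chart (p k) $ i"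
        using lim unfolding tends_to_stratum_def filterlim_at_top by blast
    qed simp
    have "filterlim (\<lambda>k. \<Sum>i\<in>\<sigma>. chart (p k) $ i * exponent v $ i) at_top sequentially"
    proof (rule filterlim_at_top_mono)
      show "filterlim (\<lambda>k. chart (p k) $ j) at_top sequentially"
        using lim j' unfolding tends_to_stratum_def by blast
      show "\<forall>\<^sub>F k in sequentially. chart (p k) $ j \<le> (\<Sum>i\<in>\<sigma>. chart (p k) $ i * exponent v $ i)"
        using pos
      proof eventually_elim
        case (elim k)
        have nonneg: "0 \<le> chart (p k) $ i * exponent v $ i" if "i \<in> \<sigma>" for i
          using elim v(1) that by (cases "i \<in> \<tau>") (auto simp: avoids_def exponent_def)
        \<comment> \<open>The exponent at \<open>j\<close> is a nonzero natural number, hence at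
          least 1.\<close>
        have "chart (p k) $ j * 1 \<le> chart (p k) $ j * exponent v $ j"
          using elim j' j(2) by (intro mult_left_mono) (auto simp: exponent_def)
        also have "\<dots> \<le> (\<Sum>i\<in>\<sigma>. chart (p k) $ i * exponent v $ i)"
          by (rule member_le_sum) (use j(1) nonneg in auto)
        finally show ?case by simp
      qed
    qed
    then have "filterlim (\<lambda>k. chart (p k) \<bullet> exponent v) at_top sequentially"
      unfolding split by (rule filterlim_tendsto_add_at_top[OF lim_fin])
    then show ?thesis
      unfolding tval_def by (rule filterlim_tendsto_add_at_top[OF tendsto_const])
  qed
  have u: "restrict_coeff \<sigma> f u \<noteq> Infty" "avoids \<sigma> u"
    using init unfolding monomial_init_def restrict_coeff_def by (auto split: if_splits)
  have "\<forall>\<^sub>F k in sequentially. \<forall>v\<in>Poly_Mapping.keys f. v \<noteq> u \<longrightarrow> restrict_coeff \<tau> f v \<noteq> Infty \<longrightarrow>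
      wval (chart (p k)) (restrict_coeff \<tau> f) u < wval (chart (p k)) (restrict_coeff \<tau> f) v"
  proof (intro eventually_ball_finite ballI)
    fix v
    show "\<forall>\<^sub>F k in sequentially. v \<noteq> u \<longrightarrow> restrict_coeff \<tau> f v \<noteq> Infty \<longrightarrow>
      wval (chart (p k)) (restrict_coeff \<tau> f) u < wval (chart (p k)) (restrict_coeff \<tau> f) v"
    proof (cases "v \<noteq> u \<and> restrict_coeff \<tau> f v \<noteq> Infty")
      case True
      then have v: "avoids \<tau> v" unfolding restrict_coeff_def by (auto split: if_splits)
      \<comment> \<open>A separating constant treats convergent and divergent terms alike.\<close>
      have "\<exists>c. wval (chart w) (restrict_coeff \<sigma> f) u < c \<and>
        (\<forall>\<^sub>F k in sequentially. c < wval (chart (p k)) (restrict_coeff \<tau> f) v)"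
      proof (cases "avoids \<sigma> v")
        case av: True
        then have "restrict_coeff \<sigma> f v \<noteq> Infty" using True v unfolding restrict_coeff_def by auto
        then have "wval (chart w) (restrict_coeff \<sigma> f) u < wval (chart w) (restrict_coeff \<sigma> f) v"
          using init True unfolding monomial_init_def by blast
        from dense[OF this] show ?thesis using order_tendstoD(1)[OF conv[OF av]] by blast
      next
        case False
        show ?thesis
          using diverge[OF v False] unfolding filterlim_at_top_dense by (meson gt_ex)
      qed
      then obtain c where c: "wval (chart w) (restrict_coeff \<sigma> f) u < c"
        "\<forall>\<^sub>F k in sequentially. c < wval (chart (p k)) (restrict_coeff \<tau> f) v" by blast
      from order_tendstoD(2)[OF conv[OF u(2)] c(1)] c(2) show ?thesis
        by eventually_elim simp
    qed auto
  qed simp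
  then obtain k where k: "\<And>v. v \<in> Poly_Mapping.keys f \<Longrightarrow> v \<noteq> u \<Longrightarrow> restrict_coeff \<tau> f v \<noteq> Infty \<Longrightarrow>
      wval (chart (p k)) (restrict_coeff \<tau> f) u < wval (chart (p k)) (restrict_coeff \<tau> f) v"
    using eventually_happens'[OF sequentially_bot] by blast
  have "v \<in> Poly_Mapping.keys f" if "restrict_coeff \<tau> f v \<noteq> Infty" for v
    using that unfolding keys_trop restrict_coeff_def by (auto split: if_splits)
  then have "monomial_init (chart (p k)) (restrict_coeff \<tau> f) u"
    using k u avoid_sub unfolding monomial_init_def by (auto simp: restrict_coeff_def)
  then show ?thesis by blast
qed

lemma ideal_variety_closure:
  assumes "P \<subseteq> stratum \<tau>" "P \<subseteq> ideal_variety I" "\<tau> \<subseteq> \<sigma>"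
  shows "closure P \<inter> stratum \<sigma> \<subseteq> ideal_variety I"
proof
  fix w assume "w \<in> closure P \<inter> stratum \<sigma>"
  then have w: "w \<in> closure P" "w \<in> stratum \<sigma>" by auto
  obtain p where p: "\<And>k. p k \<in> P" "tends_to_stratum p \<tau> w \<sigma>"
    using closure_stratum_sequence[OF w assms(1)] by blast
  have pt: "p k \<in> stratum \<tau>" for k using p(1) assms(1) by blast
  show "w \<in> ideal_variety I"
    unfolding ideal_variety_def
  proof
    fix f assume f: "f \<in> I"
    show "w \<in> variety f"
    proof (rule ccontr)
      assume "w \<notin> variety f"
      then obtain u where "monomial_init (chart w) (restrict_coeff \<sigma> f) u"
        using variety_stratum[OF w(2)] by blast
      then obtain k where "monomial_init (chart (p k)) (restrict_coeff \<tau> f) u"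
        using monomial_init_near_stratum[OF p(2) pt assms(3)] by blast
      then have "p k \<notin> variety f" using variety_stratum[OF pt] by blast
      then show False using p(1)[of k] assms(2) f unfolding ideal_variety_def by blast
    qed
  qed
qed

section \<open>Charts of strata and midpoints of boundary pieces\<close>

definition unchart :: "'n::finite set \<Rightarrow> real ^ 'n \<Rightarrow> trop ^ 'n" where
  "unchart \<sigma> x = (\<chi> i. if i \<in> \<sigma> then Infty else Fin (x $ i))"

lemma unchart_stratum: "unchart \<sigma> x \<in> stratum \<sigma>"
  by (simp add: unchart_def stratum_def)

lemma unchart_chart:
  assumes "w \<in> stratum \<sigma>"
  shows "unchart \<sigma> (chart w) = w"
proof -
  have "unchart \<sigma> (chart w) $ i = w $ i" for i
  proof (cases "w $ i")
    case (Fin a)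
    then have "i \<notin> \<sigma>" using stratum_Infty_iff[OF assms, of i] by simp
    then show ?thesis using Fin by (simp add: unchart_def chart_def)
  next
    case Infty
    then have "i \<in> \<sigma>" using stratum_Infty_iff[OF assms, of i] by simp
    then show ?thesis using Infty by (simp add: unchart_def)
  qed
  then show ?thesis by (simp add: vec_eq_iff)
qed

lemma chart_unchart: "(\<And>i. i \<in> \<sigma> \<Longrightarrow> x $ i = 0) \<Longrightarrow> chart (unchart \<sigma> x) = x"
  by (simp add: vec_eq_iff chart_def unchart_def)

lemma chart_stratum: "w \<in> stratum \<sigma> \<Longrightarrow> i \<in> \<sigma> \<Longrightarrow> chart w $ i = 0"
  using stratum_Infty_iff[of w \<sigma> i] by (simp add: chart_def)

text \<open>Average two approximating sequences inside the convex chart of \<open>P\<close>: finite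
  limits are averaged, and coordinates tending to infinity still do. Midpoints are all the convexity
  that \<open>subset_arrangement_cell\<close> asks for.\<close>

lemma closure_stratum_midpoint:
  assumes w: "w \<in> closure P \<inter> stratum \<sigma>" and z: "z \<in> closure P \<inter> stratum \<sigma>"
    and P: "P \<subseteq> stratum \<tau>" "convex (chart ` P)" and sub: "\<tau> \<subseteq> \<sigma>"
  shows "\<exists>m\<in>closure P \<inter> stratum \<sigma>. chart m = (1/2) *\<^sub>R chart w + (1/2) *\<^sub>R chart z"
proof -
  obtain p where p: "\<And>k. p k \<in> P" "tends_to_stratum p \<tau> w \<sigma>"
    using closure_stratum_sequence[OF IntD1[OF w] IntD2[OF w] P(1)] by blast
  obtain q where q: "\<And>k. q k \<in> P" "tends_to_stratum q \<tau> z \<sigma>"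
    using closure_stratum_sequence[OF IntD1[OF z] IntD2[OF z] P(1)] by blast
  have "\<exists>r\<in>P. chart r = (1/2) *\<^sub>R chart (p k) + (1/2) *\<^sub>R chart (q k)" for k
  proof -
    have "(1/2) *\<^sub>R chart (p k) + (1/2) *\<^sub>R chart (q k) \<in> chart ` P"
      using p(1) q(1) by (intro convexD[OF P(2)]) auto
    then show ?thesis by force
  qed
  then obtain r where r: "\<And>k. r k \<in> P" "\<And>k. chart (r k) = (1/2) *\<^sub>R chart (p k) + (1/2) *\<^sub>R chart (q k)"
    by metis
  let ?c = "(1/2) *\<^sub>R chart w + (1/2) *\<^sub>R chart z"
  define m where "m = unchart \<sigma> ?c"
  have c: "chart m = ?c"
    unfolding m_def by (rule chart_unchart) (simp add: chart_stratum[OF IntD2[OF w]] chart_stratum[OF IntD2[OF z]])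
  have "tends_to_stratum r \<tau> m \<sigma>"
    unfolding tends_to_stratum_def
  proof (intro conjI allI impI ballI)
    fix i assume i: "i \<notin> \<sigma>"
    show "(\<lambda>k. chart (r k) $ i) \<longlonglongrightarrow> chart m $ i"
    proof -
      have "(\<lambda>k. 1/2 * chart (p k) $ i + 1/2 * chart (q k) $ i) \<longlonglongrightarrow> 1/2 * chart w $ i + 1/2 * chart z $ i"
        using p(2) q(2) i unfolding tends_to_stratum_def
        by (intro tendsto_add tendsto_mult tendsto_const) auto
      then show ?thesis unfolding r(2) c by simp
    qed
  next
    fix i assume i: "i \<in> \<sigma> - \<tau>"
    have "filterlim (\<lambda>k. chart (p k) $ i + chart (q k) $ i) at_top sequentially"
      using p(2) q(2) i unfolding tends_to_stratum_def by (intro filterlim_at_top_add_at_top) auto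
    from filterlim_tendsto_pos_mult_at_top[OF tendsto_const _ this, of "1/2"]
    have "filterlim (\<lambda>k. (1/2) * (chart (p k) $ i + chart (q k) $ i)) at_top sequentially" by simp
    then show "filterlim (\<lambda>k. chart (r k) $ i) at_top sequentially"
      unfolding r(2) by (simp add: algebra_simps)
  qed
  then have "m \<in> closure P"
    by (rule closure_stratum_of_sequence[OF r(1)]) (use unchart_stratum P sub in \<open>auto simp: m_def\<close>)
  then show ?thesis using c unchart_stratum unfolding m_def by blast
qed

section \<open>The polyhedral complex\<close>

text \<open>Give the variables distinct primes \<open>p i\<close> and let \<kappa> be the logarithm
  of the resulting product of prime powers; unique factorization makes it injective.\<close>

lemma exists_additive_tiebreak:
  "\<exists>\<kappa> :: ('n::finite \<Rightarrow>\<^sub>0 nat) \<Rightarrow> real. inj \<kappa> \<and> (\<forall>u v. \<kappa> (u + v) = \<kappa> u + \<kappa> v)"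
proof -
  obtain B :: "nat set" where B: "finite B" "card B = card (UNIV :: 'n set)" "B \<subseteq> {p. prime p}"
    using infinite_arbitrarily_large[OF primes_infinite] by blast
  then obtain p :: "'n \<Rightarrow> nat" where p: "bij_betw p UNIV B"
    using finite_same_card_bij[of "UNIV :: 'n set" B] by auto
  then have prime: "prime (p i)" for i using B(3) unfolding bij_betw_def by blast
  have inj: "inj p" using p unfolding bij_betw_def by blast
  define \<kappa> :: "('n \<Rightarrow>\<^sub>0 nat) \<Rightarrow> real" where
    "\<kappa> u = (\<Sum>i\<in>UNIV. real (Poly_Mapping.lookup u i) * ln (real (p i)))" for u
  have pos: "0 < p i" for i using prime prime_gt_0_nat by blast
  have exp: "exp (\<kappa> u) = real (\<Prod>i\<in>UNIV. p i ^ Poly_Mapping.lookup u i)" for u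
    using pos by (simp add: \<kappa>_def exp_sum exp_of_nat_mult)
  have "u = v" if "\<kappa> u = \<kappa> v" for u v
  proof -
    have "real (\<Prod>i\<in>UNIV. p i ^ Poly_Mapping.lookup u i) = real (\<Prod>i\<in>UNIV. p i ^ Poly_Mapping.lookup v i)"
      using exp[of u] exp[of v] that by simp
    then have eq: "(\<Prod>i\<in>UNIV. p i ^ Poly_Mapping.lookup u i) = (\<Prod>i\<in>UNIV. p i ^ Poly_Mapping.lookup v i)"
      by (simp only: of_nat_eq_iff)
    have mult: "multiplicity (p j) (\<Prod>i\<in>UNIV. p i ^ Poly_Mapping.lookup w i) = Poly_Mapping.lookup w j"
      for w :: "'n \<Rightarrow>\<^sub>0 nat" and j
    proof -
      \<comment> \<open>Reindexed by the primes themselves, the form in which multiplicities can be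
        read off.\<close>
      have "(\<Prod>i\<in>UNIV. p i ^ Poly_Mapping.lookup w i) = (\<Prod>q\<in>range p. q ^ Poly_Mapping.lookup w (inv p q))"
        using inj by (simp add: prod.reindex)
      also have "multiplicity (p j) \<dots> = Poly_Mapping.lookup w j"
        using prime inj by (subst multiplicity_prod_prime_powers) auto
      finally show ?thesis .
    qed
    show "u = v" by (rule poly_mapping_eqI) (metis eq mult)
  qed
  moreover have "\<kappa> (u + v) = \<kappa> u + \<kappa> v" for u v
    by (simp add: \<kappa>_def lookup_add sum.distrib algebra_simps)
  ultimately show ?thesis unfolding inj_def by blast
qed

section \<open>Restriction of a tropical ideal to a stratum\<close>

lemma lookup_single_times:
  fixes f :: "('n \<Rightarrow>\<^sub>0 nat) \<Rightarrow>\<^sub>0 'b::comm_semiring_1"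
  shows "Poly_Mapping.lookup (Poly_Mapping.single m c * f) (v + m) = c * Poly_Mapping.lookup f v"
proof -
  have "Poly_Mapping.lookup (Poly_Mapping.single m c * f) (v + m) =
      (\<Sum>l. (c * (\<Sum>q. Poly_Mapping.lookup f q when v + m = l + q)) when m = l)"
    by (simp add: lookup_mult lookup_single when_mult)
  also have "\<dots> = c * (\<Sum>q. Poly_Mapping.lookup f q when v + m = m + q)"
    by simp
  also have "(\<Sum>q. Poly_Mapping.lookup f q when v + m = m + q) = (\<Sum>q. Poly_Mapping.lookup f q when v = q)"
    by (simp add: add.commute[of v])
  finally show ?thesis by simp
qed

lemma keys_single_times:
  fixes f :: "('n \<Rightarrow>\<^sub>0 nat) \<Rightarrow>\<^sub>0 'b::comm_semiring_1"
  assumes "v \<in> Poly_Mapping.keys (Poly_Mapping.single m c * f)"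
  obtains u where "u \<in> Poly_Mapping.keys f" "v = u + m"
proof -
  obtain a b where ab: "a \<in> Poly_Mapping.keys (Poly_Mapping.single m c)" "b \<in> Poly_Mapping.keys f" "v = a + b"
    using subsetD[OF keys_mult assms] by blast
  then have "a = m" by (simp split: if_splits)
  then show ?thesis using that[OF ab(2)] ab(3) by (simp add: add.commute)
qed

definition monomials :: "'n::finite set \<Rightarrow> nat \<Rightarrow> ('n \<Rightarrow>\<^sub>0 nat) set" where
  "monomials \<sigma> d = {u. avoids \<sigma> u \<and> monomial_degree u \<le> d}"

lemma finite_monomials: "finite (monomials \<sigma> d)"
proof -
  have "Poly_Mapping.lookup u i \<le> d" if "u \<in> monomials \<sigma> d" for u i
  proof -
    have "Poly_Mapping.lookup u i \<le> monomial_degree u"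
      unfolding monomial_degree_def by (rule member_le_sum) auto
    then show ?thesis using that unfolding monomials_def by simp
  qed
  then have "Poly_Mapping.lookup ` monomials \<sigma> d \<subseteq> (\<Pi>\<^sub>E i\<in>UNIV. {..d})"
    by auto
  then have "finite (Poly_Mapping.lookup ` monomials \<sigma> d)"
    by (rule finite_subset) (simp add: finite_PiE)
  then show ?thesis
    by (rule finite_imageD) (simp add: inj_on_def lookup_inject)
qed

lemma degree_le_part_single_times:
  assumes I: "semiring_ideal I" and f: "f \<in> degree_le_part I d" and d: "d + monomial_degree m \<le> d'"
  shows "Poly_Mapping.single m c * f \<in> degree_le_part I d'"
  unfolding degree_le_part_def
proof (intro CollectI conjI ballI)
  show "Poly_Mapping.single m c * f \<in> I"
    using I f unfolding semiring_ideal_def degree_le_part_def by blast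
  fix v assume "v \<in> Poly_Mapping.keys (Poly_Mapping.single m c * f)"
  then obtain u where "u \<in> Poly_Mapping.keys f" "v = u + m" by (rule keys_single_times)
  then show "monomial_degree v \<le> d'"
    using f d unfolding degree_le_part_def by (fastforce simp: monomial_degree_add)
qed

lemma restrict_coeff_monomials:
  assumes "f \<in> degree_le_part I d" "restrict_coeff \<sigma> f u \<noteq> Infty"
  shows "u \<in> monomials \<sigma> d"
proof -
  have "avoids \<sigma> u" "u \<in> Poly_Mapping.keys f"
    using assms(2) unfolding restrict_coeff_def keys_trop by (auto split: if_splits)
  then show ?thesis using assms(1) unfolding monomials_def degree_le_part_def by blast
qed

text \<open>Elimination is a condition on each coefficient separately, so it survives the deletion
  of terms.\<close>

lemma tropical_ideal_graded_vectors:
  assumes I: "tropical_ideal I" and \<kappa>: "inj \<kappa>" "\<And>u v. \<kappa> (u + v) = \<kappa> u + \<kappa> v"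
  shows "graded_vectors (monomials \<sigma>) (\<lambda>d. restrict_coeff \<sigma> ` degree_le_part I d) \<kappa>"
proof (rule graded_vectors.intro)
  fix d
  have ideal: "semiring_ideal I" using I unfolding tropical_ideal_def by blast
  let ?L = "\<lambda>d. restrict_coeff \<sigma> ` degree_le_part I d"
  show "valuated_vectors (monomials \<sigma> d) (?L d) \<kappa>"
  proof (rule valuated_vectors.intro)
    show "finite (monomials \<sigma> d)" by (rule finite_monomials)
    show "u \<in> monomials \<sigma> d" if "f \<in> ?L d" "f u \<noteq> Infty" for f u
      using that restrict_coeff_monomials by blast
    show "inj_on \<kappa> (monomials \<sigma> d)" using \<kappa>(1) inj_on_subset by blast
    show "(\<lambda>u. Fin c * f u) \<in> ?L d" if f: "f \<in> ?L d" for f c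
    proof -
      obtain f0 where f0: "f0 \<in> degree_le_part I d" "f = restrict_coeff \<sigma> f0" using f by blast
      have "(\<lambda>u. Fin c * f u) = restrict_coeff \<sigma> (Poly_Mapping.single 0 (Fin c) * f0)"
        using lookup_single_times[of 0 "Fin c" f0] by (auto simp: f0(2) restrict_coeff_def)
      moreover have "Poly_Mapping.single 0 (Fin c) * f0 \<in> degree_le_part I d"
        by (rule degree_le_part_single_times[OF ideal f0(1)]) (simp add: monomial_degree_def)
      ultimately show ?thesis by blast
    qed
    show "\<exists>h\<in>?L d. h u = Infty \<and> (\<forall>v. min (f v) (g v) \<le> h v \<and> (f v \<noteq> g v \<longrightarrow> h v = min (f v) (g v)))"
      if f: "f \<in> ?L d" and g: "g \<in> ?L d" and u: "f u = g u" "f u \<noteq> Infty" for f g u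
    proof -
      obtain f0 g0 where fg: "f0 \<in> degree_le_part I d" "f = restrict_coeff \<sigma> f0"
        "g0 \<in> degree_le_part I d" "g = restrict_coeff \<sigma> g0" using f g by blast
      \<comment> \<open>A finite coefficient was not deleted, so the original polynomials agree at
        \<open>u\<close> and can be eliminated there.\<close>
      have "avoids \<sigma> u" using u(2) unfolding fg restrict_coeff_def by (auto split: if_splits)
      then have "Poly_Mapping.lookup f0 u = Poly_Mapping.lookup g0 u" "Poly_Mapping.lookup f0 u \<noteq> Infty"
        using u unfolding fg restrict_coeff_def by auto
      then obtain h0 where h0: "h0 \<in> degree_le_part I d" "Poly_Mapping.lookup h0 u = Infty"
        "\<And>v. min (Poly_Mapping.lookup f0 v) (Poly_Mapping.lookup g0 v) \<le> Poly_Mapping.lookup h0 v"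
        "\<And>v. Poly_Mapping.lookup f0 v \<noteq> Poly_Mapping.lookup g0 v \<Longrightarrow>
          Poly_Mapping.lookup h0 v = min (Poly_Mapping.lookup f0 v) (Poly_Mapping.lookup g0 v)"
        using I fg(1,3) unfolding tropical_ideal_def by metis
      show ?thesis
        by (rule bexI[OF _ imageI[OF h0(1)]])
          (use h0(2-4) in \<open>auto simp: fg restrict_coeff_def\<close>)
    qed
  qed
  show "monomial_degree u \<le> d" if "u \<in> monomials \<sigma> d" for u
    using that unfolding monomials_def by blast
  show "\<kappa> (u + v) = \<kappa> u + \<kappa> v" for u v by (rule \<kappa>(2))
  show "\<exists>g\<in>?L d'. (\<forall>v. g (v + m) = f v) \<and> (\<forall>v. g v \<noteq> Infty \<longrightarrow> (\<exists>x. v = x + m))"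
    if f: "f \<in> ?L d" and u: "u + m \<in> monomials \<sigma> d'" and d: "d + monomial_degree m \<le> d'" for f d' u m
  proof -
    obtain f0 where f0: "f0 \<in> degree_le_part I d" "f = restrict_coeff \<sigma> f0" using f by blast
    define g0 where "g0 = Poly_Mapping.single m 1 * f0"
    \<comment> \<open>Because \<open>u + m\<close> avoids \<sigma>, so does \<open>m\<close>, and
      multiplication by it commutes with deleting the terms that involve \<sigma>.\<close>
    have m: "avoids \<sigma> m" using u unfolding monomials_def avoids_def by (simp add: lookup_add)
    have "g0 \<in> degree_le_part I d'"
      unfolding g0_def by (rule degree_le_part_single_times[OF ideal f0(1) d])
    moreover have "restrict_coeff \<sigma> g0 (v + m) = f v" for v
      using m lookup_single_times[of m 1 f0 v]
      by (simp add: f0(2) g0_def restrict_coeff_def avoids_def lookup_add)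
    moreover have "\<exists>x. v = x + m" if "restrict_coeff \<sigma> g0 v \<noteq> Infty" for v
    proof -
      have "v \<in> Poly_Mapping.keys g0"
        using that unfolding restrict_coeff_def keys_trop by (auto split: if_splits)
      then show ?thesis unfolding g0_def by (rule keys_single_times) blast
    qed
    ultimately show ?thesis by blast
  qed
qed

lemma mem_degree_le_part:
  assumes "f \<in> I"
  obtains d where "f \<in> degree_le_part I d"
proof -
  obtain d where "\<forall>x\<in>monomial_degree ` Poly_Mapping.keys f. x \<le> d"
    using finite_nat_set_iff_bounded_le[of "monomial_degree ` Poly_Mapping.keys f"] by auto
  then show ?thesis using that[of d] assms unfolding degree_le_part_def by auto
qed

lemma restricted_variety_polyhedral:
  assumes "tropical_ideal I"
  shows "\<exists>\<P>. finite \<P> \<and> (\<forall>P\<in>\<P>. polyhedron P) \<and>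
    \<Union>\<P> = {x. \<forall>f\<in>I. \<forall>u. \<not> monomial_init x (restrict_coeff \<sigma> f) u}"
proof -
  obtain \<kappa> :: "('a \<Rightarrow>\<^sub>0 nat) \<Rightarrow> real" where \<kappa>: "inj \<kappa>" "\<And>u v. \<kappa> (u + v) = \<kappa> u + \<kappa> v"
    using exists_additive_tiebreak by blast
  interpret graded_vectors "monomials \<sigma>" "\<lambda>d. restrict_coeff \<sigma> ` degree_le_part I d" \<kappa>
    by (rule tropical_ideal_graded_vectors[OF assms \<kappa>])
  have "monomial_free = {x. \<forall>f\<in>I. \<forall>u. \<not> monomial_init x (restrict_coeff \<sigma> f) u}"
  proof (intro set_eqI iffI; clarsimp)
    fix x f u assume x: "x \<in> monomial_free" and f: "f \<in> I" "monomial_init x (restrict_coeff \<sigma> f) u"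
    obtain d where "f \<in> degree_le_part I d" using mem_degree_le_part[OF f(1)] .
    then show False using x f(2) unfolding monomial_free_def by blast
  next
    fix x assume "\<forall>f\<in>I. \<forall>u. \<not> monomial_init x (restrict_coeff \<sigma> f) u"
    then show "x \<in> monomial_free" unfolding monomial_free_def by (auto simp: degree_le_part_def)
  qed
  then show ?thesis using monomial_free_polyhedral by simp
qed

definition coordinate_zero :: "'n::finite set \<Rightarrow> (real ^ 'n) set" where
  "coordinate_zero \<sigma> = {x. \<forall>i\<in>\<sigma>. x $ i = 0}"

lemma chart_variety_stratum:
  "chart ` (ideal_variety I \<inter> stratum \<sigma>) =
    {x. \<forall>f\<in>I. \<forall>u. \<not> monomial_init x (restrict_coeff \<sigma> f) u} \<inter> coordinate_zero \<sigma>"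
proof (intro set_eqI iffI)
  fix x assume "x \<in> chart ` (ideal_variety I \<inter> stratum \<sigma>)"
  then obtain w where w: "x = chart w" "\<And>f. f \<in> I \<Longrightarrow> w \<in> variety f" "w \<in> stratum \<sigma>"
    unfolding ideal_variety_def by blast
  then show "x \<in> {x. \<forall>f\<in>I. \<forall>u. \<not> monomial_init x (restrict_coeff \<sigma> f) u} \<inter> coordinate_zero \<sigma>"
    using variety_stratum[OF w(3)] chart_stratum[OF w(3)] unfolding coordinate_zero_def by blast
next
  fix x assume x: "x \<in> {x. \<forall>f\<in>I. \<forall>u. \<not> monomial_init x (restrict_coeff \<sigma> f) u} \<inter> coordinate_zero \<sigma>"
  then have c: "chart (unchart \<sigma> x) = x"
    by (intro chart_unchart) (auto simp: coordinate_zero_def)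
  have "unchart \<sigma> x \<in> variety f" if "f \<in> I" for f
    using x that variety_stratum[OF unchart_stratum[of \<sigma> x], of f] unfolding c by blast
  then have "unchart \<sigma> x \<in> ideal_variety I \<inter> stratum \<sigma>"
    using unchart_stratum unfolding ideal_variety_def by blast
  then show "x \<in> chart ` (ideal_variety I \<inter> stratum \<sigma>)" using c by (metis imageI)
qed

text \<open>
  On \<open>coordinate_zero \<sigma>\<close> the \<open>\<sigma>\<close>-coordinates of the normal vectors are irrelevant.  Setting them to
  zero makes the same affine forms usable on all strata \<open>\<tau> \<subseteq> \<sigma>\<close>, where they extend continuously
  to the boundary stratum \<open>\<sigma>\<close>.
\<close>

lemma variety_stratum_arrangement:
  assumes "tropical_ideal I"
  shows "\<exists>H. finite H \<and> (\<forall>(a, b)\<in>H. \<forall>i\<in>\<sigma>. a $ i = 0) \<and>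
    (\<forall>x\<in>chart ` (ideal_variety I \<inter> stratum \<sigma>).
      arrangement_cell H x \<inter> coordinate_zero \<sigma> \<subseteq> chart ` (ideal_variety I \<inter> stratum \<sigma>))"
proof -
  define S where "S = {x. \<forall>f\<in>I. \<forall>u. \<not> monomial_init x (restrict_coeff \<sigma> f) u}"
  have chart: "chart ` (ideal_variety I \<inter> stratum \<sigma>) = S \<inter> coordinate_zero \<sigma>"
    unfolding S_def by (rule chart_variety_stratum)
  obtain \<P> where \<P>: "finite \<P>" "\<And>P. P \<in> \<P> \<Longrightarrow> polyhedron P" "\<Union>\<P> = S"
    using restricted_variety_polyhedral[OF assms, of \<sigma>] unfolding S_def by blast
  obtain H0 where H0: "finite H0" "\<And>x. x \<in> S \<Longrightarrow> arrangement_cell H0 x \<subseteq> S"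
    using polyhedra_arrangement[OF \<P>(1,2)] unfolding \<P>(3) by blast
  define r :: "real ^ 'a \<Rightarrow> real ^ 'a" where "r a = (\<chi> i. if i \<in> \<sigma> then 0 else a $ i)" for a
  have r: "r a \<bullet> x = a \<bullet> x" if "x \<in> coordinate_zero \<sigma>" for a x
    using that unfolding r_def coordinate_zero_def inner_vec_def by (intro sum.cong) auto
  define H where "H = (\<lambda>(a, b). (r a, b)) ` H0"
  have "arrangement_cell H x \<inter> coordinate_zero \<sigma> \<subseteq> arrangement_cell H0 x" if "x \<in> coordinate_zero \<sigma>" for x
    using that unfolding arrangement_cell_def H_def by (auto simp: r)
  then have "arrangement_cell H x \<inter> coordinate_zero \<sigma> \<subseteq> S \<inter> coordinate_zero \<sigma>"
    if "x \<in> S \<inter> coordinate_zero \<sigma>" for x using H0(2)[of x] that by blast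
  moreover have "finite H" "\<forall>(a, b)\<in>H. \<forall>i\<in>\<sigma>. a $ i = 0"
    using H0(1) unfolding H_def r_def by auto
  ultimately show ?thesis unfolding chart by (intro exI[of _ H]) simp
qed

text \<open>A point of \<open>K\<close> lying off as many of the hyperplanes as possible; averaging shows that it
  lies off every hyperplane that does not contain \<open>K\<close>.\<close>

lemma subset_arrangement_cell:
  assumes "finite H" "K \<noteq> {}"
    and mid: "\<And>x y. x \<in> K \<Longrightarrow> y \<in> K \<Longrightarrow> (1/2) *\<^sub>R x + (1/2) *\<^sub>R y \<in> K"
    and side: "\<And>a b. (a, b) \<in> H \<Longrightarrow> (\<forall>x\<in>K. a \<bullet> x \<le> b) \<or> (\<forall>x\<in>K. b \<le> a \<bullet> x)"
  shows "\<exists>x\<in>K. K \<subseteq> arrangement_cell H x"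
proof -
  define N where "N x = {(a, b). (a, b) \<in> H \<and> a \<bullet> x \<noteq> b}" for x
  have finN: "finite (N x)" for x
    by (rule finite_subset[OF _ assms(1)]) (auto simp: N_def)
  have "\<exists>x\<in>K. \<forall>y\<in>K. card (N y) \<le> card (N x)"
  proof -
    obtain x0 where "x0 \<in> K" using assms(2) by blast
    moreover have "\<forall>y. y \<in> K \<longrightarrow> card (N y) < Suc (card H)"
      using assms(1) by (auto simp: less_Suc_eq_le N_def intro!: card_mono)
    ultimately show ?thesis using ex_has_greatest_nat[of "\<lambda>x. x \<in> K" x0 "\<lambda>x. card (N x)"] by blast
  qed
  then obtain x where x: "x \<in> K" "\<And>y. y \<in> K \<Longrightarrow> card (N y) \<le> card (N x)" by blast
  have zero: "a \<bullet> y = b" if ab: "(a, b) \<in> H" "a \<bullet> x = b" and y: "y \<in> K" for a b y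
  proof (rule ccontr)
    assume ne: "a \<bullet> y \<noteq> b"
    let ?m = "(1/2) *\<^sub>R x + (1/2) *\<^sub>R y"
    have m: "c \<bullet> ?m = (c \<bullet> x + c \<bullet> y) / 2" for c by (simp add: inner_add_right)
    \<comment> \<open>\<open>K\<close> lies on one side of each hyperplane, so a strict inequality
      at \<open>x\<close> cannot be cancelled at the midpoint.\<close>
    have "N x \<subseteq> N ?m"
      using side x(1) y unfolding N_def by (clarsimp simp: m) (smt (verit, best) field_sum_of_halves)
    moreover have "(a, b) \<in> N ?m - N x" using ab ne by (simp add: N_def m)
    ultimately have "card (N x) < card (N ?m)" by (intro psubset_card_mono finN) blast
    then show False using x(2)[OF mid[OF x(1) y]] by simp
  qed
  have "K \<subseteq> arrangement_cell H x"
    unfolding arrangement_cell_def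
  proof (intro subsetI CollectI ballI, clarify)
    fix y a b assume y: "y \<in> K" and ab: "(a, b) \<in> H"
    show "(a \<bullet> x \<le> b \<longrightarrow> a \<bullet> y \<le> b) \<and> (b \<le> a \<bullet> x \<longrightarrow> b \<le> a \<bullet> y)"
      using side[OF ab] zero[OF ab _ y] x(1) y by (metis dual_order.antisym order_refl)
  qed
  then show ?thesis using x(1) by blast
qed

theorem theorem1p2:
  fixes I :: "'n::finite trop_poly set"
  assumes "tropical_ideal I"
  shows "\<exists>\<Delta> :: 'n set \<Rightarrow> (trop ^ 'n) set set.
           trop_polyhedral_complex \<Delta> \<and> finite_complex \<Delta> \<and>
           complex_support \<Delta> = ideal_variety I"
proof -
  define X where "X \<sigma> = chart ` (ideal_variety I \<inter> stratum \<sigma>)" for \<sigma>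
  have X_zero: "X \<sigma> \<subseteq> coordinate_zero \<sigma>" for \<sigma>
    unfolding X_def chart_variety_stratum by blast
  obtain H0 where H0: "\<And>\<sigma>. finite (H0 \<sigma>)" "\<And>\<sigma> a b i. (a, b) \<in> H0 \<sigma> \<Longrightarrow> i \<in> \<sigma> \<Longrightarrow> a $ i = 0"
    "\<And>\<sigma> x. x \<in> X \<sigma> \<Longrightarrow> arrangement_cell (H0 \<sigma>) x \<inter> coordinate_zero \<sigma> \<subseteq> X \<sigma>"
  proof -
    have "\<forall>\<sigma>. \<exists>H. finite H \<and> (\<forall>(a, b)\<in>H. \<forall>i\<in>\<sigma>. a $ i = 0) \<and>
      (\<forall>x\<in>X \<sigma>. arrangement_cell H x \<inter> coordinate_zero \<sigma> \<subseteq> X \<sigma>)"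
      unfolding X_def using variety_stratum_arrangement[OF assms] by blast
    then obtain H where H: "\<forall>\<sigma>. finite (H \<sigma>) \<and> (\<forall>(a, b)\<in>H \<sigma>. \<forall>i\<in>\<sigma>. a $ i = 0) \<and>
      (\<forall>x\<in>X \<sigma>. arrangement_cell (H \<sigma>) x \<inter> coordinate_zero \<sigma> \<subseteq> X \<sigma>)"
      by (rule choice[THEN exE])
    show ?thesis by (rule that[of H]) (use H in blast)+
  qed
  \<comment> \<open>Collecting the forms of all strata makes every non-coordinate form used on
    \<sigma> available on each \<tau> \<subseteq> \<sigma>. The coordinate forms keep the cells
    inside \<open>coordinate_zero \<sigma>\<close>.\<close>
  define H where "H \<sigma> = {(a, b) \<in> (\<Union>\<tau>. H0 \<tau>). \<forall>i\<in>\<sigma>. a $ i = 0} \<union> (\<lambda>i. (axis i 1, 0)) ` \<sigma>" for \<sigma>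
  have finH: "finite (H \<sigma>)" for \<sigma>
  proof -
    have "finite (\<Union>\<tau>. H0 \<tau>)" using H0(1) by simp
    then have "finite {(a, b) \<in> (\<Union>\<tau>. H0 \<tau>). \<forall>i\<in>\<sigma>. a $ i = 0}"
      by (rule rev_finite_subset) auto
    then show ?thesis unfolding H_def by simp
  qed
  have cell_X: "arrangement_cell (H \<sigma>) x \<subseteq> X \<sigma>" if x: "x \<in> X \<sigma>" for \<sigma> x
  proof
    fix y assume y: "y \<in> arrangement_cell (H \<sigma>) x"
    have "y $ i = 0" if i: "i \<in> \<sigma>" for i
    proof -
      have h: "(axis i 1, 0) \<in> H \<sigma>" using i unfolding H_def by blast
      have "axis i 1 \<bullet> x = 0" using X_zero x i unfolding coordinate_zero_def by (auto simp: inner_axis')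
      then have "axis i 1 \<bullet> y = 0" using arrangement_cellD[OF y h] by simp
      then show ?thesis by (simp add: inner_axis')
    qed
    then have "y \<in> coordinate_zero \<sigma>" unfolding coordinate_zero_def by blast
    moreover have "H0 \<sigma> \<subseteq> H \<sigma>" unfolding H_def using H0(2) by blast
    then have "y \<in> arrangement_cell (H0 \<sigma>) x" using y arrangement_cell_mono by blast
    ultimately show "y \<in> X \<sigma>" using H0(3)[OF x] by blast
  qed
  define C where "C \<sigma> = insert {} (arrangement_cell (H \<sigma>) ` X \<sigma>)" for \<sigma>
  define \<Delta> where "\<Delta> \<sigma> = (\<lambda>Q. unchart \<sigma> ` Q) ` C \<sigma>" for \<sigma>
  have chart_id: "chart ` unchart \<sigma> ` Q = Q" if "Q \<subseteq> X \<sigma>" for Q \<sigma>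
  proof -
    have "chart (unchart \<sigma> x) = x" if "x \<in> Q" for x
      by (rule chart_unchart) (use that \<open>Q \<subseteq> X \<sigma>\<close> X_zero in \<open>auto simp: coordinate_zero_def\<close>)
    then show ?thesis by (simp add: image_image)
  qed
  have C_sub: "Q \<subseteq> X \<sigma>" if "Q \<in> C \<sigma>" for Q \<sigma>
    using that cell_X unfolding C_def by auto
  have unchart_X: "unchart \<sigma> ` X \<sigma> = ideal_variety I \<inter> stratum \<sigma>" for \<sigma>
    unfolding X_def image_image using unchart_chart by force
  have stratum: "stratum_complex \<sigma> (\<Delta> \<sigma>)" for \<sigma>
  proof -
    have "(\<lambda>P. chart ` P) ` \<Delta> \<sigma> = (\<lambda>Q. Q) ` C \<sigma>"
      unfolding \<Delta>_def image_image[of "\<lambda>P. chart ` P"] by (intro image_cong refl chart_id C_sub)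
    moreover have "polyhedral_complex (C \<sigma>)"
      unfolding C_def by (rule polyhedral_complex_arrangement_cells[OF finH cell_X])
    ultimately show ?thesis
      unfolding stratum_complex_def \<Delta>_def using unchart_stratum by auto
  qed
  have "complex_support \<Delta> = ideal_variety I"
  proof -
    have "\<Union>(C \<sigma>) = X \<sigma>" for \<sigma>
    proof
      show "\<Union>(C \<sigma>) \<subseteq> X \<sigma>" using C_sub by (rule Union_least)
      show "X \<sigma> \<subseteq> \<Union>(C \<sigma>)" unfolding C_def using arrangement_cell_refl by fastforce
    qed
    then have "\<Union>(\<Delta> \<sigma>) = ideal_variety I \<inter> stratum \<sigma>" for \<sigma>
      unfolding \<Delta>_def image_Union[symmetric] by (simp add: unchart_X)
    moreover have "w \<in> stratum {i. w $ i = Infty}" for w :: "trop ^ 'n"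
      unfolding stratum_def by simp
    ultimately show ?thesis unfolding complex_support_def by blast
  qed
  moreover have "finite_complex \<Delta>"
    unfolding finite_complex_def \<Delta>_def C_def
    using finite_subset[OF image_mono[OF subset_UNIV] finite_arrangement_cells[OF finH]] by simp
  moreover have "\<exists>Q\<in>\<Delta> \<sigma>. closure P \<inter> stratum \<sigma> \<subseteq> Q" if sub: "\<tau> \<subseteq> \<sigma>" and P: "P \<in> \<Delta> \<tau>" for \<tau> \<sigma> P
  proof -
    define K where "K = closure P \<inter> stratum \<sigma>"
    show ?thesis
    proof (cases "K = {}")
      case True
      \<comment> \<open>The empty set belongs to every \<open>\<Delta> \<sigma>\<close>.\<close>
      then show ?thesis using P unfolding K_def[symmetric] \<Delta>_def C_def by auto
    next
      case False
      obtain Q where Q: "Q \<in> C \<tau>" "P = unchart \<tau> ` Q" using P unfolding \<Delta>_def by blast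
      have PQ: "chart ` P = Q" unfolding Q(2) by (rule chart_id[OF C_sub[OF Q(1)]])
      have P_var: "P \<subseteq> ideal_variety I" "P \<subseteq> stratum \<tau>"
        using C_sub[OF Q(1)] unchart_X[of \<tau>] unfolding Q(2) by blast+
      have "Q \<noteq> {}" using False Q(2) unfolding K_def by auto
      then obtain x0 where x0: "Q = arrangement_cell (H \<tau>) x0" using Q(1) unfolding C_def by blast
      have conv: "convex (chart ` P)"
        unfolding PQ x0 by (rule polyhedron_imp_convex[OF polyhedron_arrangement_cell[OF finH]])
      have K_var: "K \<subseteq> ideal_variety I \<inter> stratum \<sigma>"
        using ideal_variety_closure[OF P_var(2,1) sub] unfolding K_def by blast
      \<comment> \<open>A form whose normal vanishes on \<sigma> ignores the coordinates that run
        off to infinity, so its weak inequalities pass to the limit.\<close>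
      have lim: "a \<bullet> chart w \<le> b"
        if ab: "\<And>i. i \<in> \<sigma> \<Longrightarrow> a $ i = 0" "\<And>y. y \<in> Q \<Longrightarrow> a \<bullet> y \<le> b" and w: "w \<in> K" for a b w
      proof -
        obtain p where p: "\<And>k. p k \<in> P" "tends_to_stratum p \<tau> w \<sigma>"
          using closure_stratum_sequence[of w P \<sigma> \<tau>] w P_var(2) unfolding K_def by blast
        have "(\<lambda>k. a $ i * chart (p k) $ i) \<longlonglongrightarrow> a $ i * chart w $ i" for i
        proof (cases "i \<in> \<sigma>")
          case False
          then show ?thesis using p(2) unfolding tends_to_stratum_def by (intro tendsto_mult) auto
        qed (simp add: ab(1))
        then have "(\<lambda>k. a \<bullet> chart (p k)) \<longlonglongrightarrow> a \<bullet> chart w"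
          unfolding inner_vec_def by (intro tendsto_sum) simp
        then show ?thesis
          by (rule LIMSEQ_le_const2) (use ab(2) p(1) PQ in blast)
      qed
      have "\<exists>x\<in>chart ` K. chart ` K \<subseteq> arrangement_cell (H \<sigma>) x"
      proof (rule subset_arrangement_cell[OF finH])
        show "chart ` K \<noteq> {}" using False by simp
        show "(1/2) *\<^sub>R x + (1/2) *\<^sub>R y \<in> chart ` K" if xy: "x \<in> chart ` K" "y \<in> chart ` K" for x y
        proof -
          obtain w z where wz: "w \<in> K" "z \<in> K" "x = chart w" "y = chart z" using xy by blast
          then show ?thesis
            using closure_stratum_midpoint[of w P \<sigma> z \<tau>] P_var(2) conv sub unfolding K_def
            by (metis (no_types, lifting) imageI)
        qed
        show "(\<forall>x\<in>chart ` K. a \<bullet> x \<le> b) \<or> (\<forall>x\<in>chart ` K. b \<le> a \<bullet> x)" if ab: "(a, b) \<in> H \<sigma>" for a b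
        proof (cases "\<forall>i\<in>\<sigma>. a $ i = 0")
          case True
          \<comment> \<open>The normal of a coordinate form for \<sigma> has an entry 1 in \<sigma>,
            so \<open>(a, b)\<close> comes from the common collection; its normal vanishes on \<tau>
            too, and the cell \<open>Q\<close> lies on one side of it.\<close>
          then have "(a, b) \<in> H \<tau>"
            using ab sub unfolding H_def by (auto simp: axis_def)
          note side = arrangement_cellD[OF _ this, of _ x0, folded x0]
          consider "a \<bullet> x0 \<le> b" | "b \<le> a \<bullet> x0" by linarith
          then show ?thesis
          proof cases
            case 1
            then show ?thesis using lim[of a b] True side(1) by blast
          next
            case 2
            \<comment> \<open>The other side follows by passing to the negated form.\<close>
            then have "(- a) \<bullet> chart w \<le> - b" if "w \<in> K" for w
              by (intro lim[OF _ _ that]) (use True side(2) in auto)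
            then show ?thesis by auto
          qed
        next
          case False
          \<comment> \<open>What remains is a coordinate form, which vanishes on the chart of the
            stratum.\<close>
          then obtain i where "i \<in> \<sigma>" "a = axis i 1" "b = 0" using ab unfolding H_def by auto
          then have "a \<bullet> chart w = b" if "w \<in> K" for w
            using that chart_stratum unfolding K_def by (auto simp: inner_axis')
          then show ?thesis by auto
        qed
      qed
      then obtain x where x: "x \<in> chart ` K" "chart ` K \<subseteq> arrangement_cell (H \<sigma>) x" by blast
      have "x \<in> X \<sigma>" using x(1) K_var unfolding X_def by blast
      then have "unchart \<sigma> ` arrangement_cell (H \<sigma>) x \<in> \<Delta> \<sigma>" unfolding \<Delta>_def C_def by blast
      moreover have "K \<subseteq> unchart \<sigma> ` arrangement_cell (H \<sigma>) x"
      proof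
        fix w assume w: "w \<in> K"
        then have "unchart \<sigma> (chart w) = w" using unchart_chart unfolding K_def by blast
        moreover have "chart w \<in> arrangement_cell (H \<sigma>) x" using x(2) w by blast
        ultimately show "w \<in> unchart \<sigma> ` arrangement_cell (H \<sigma>) x" by (metis imageI)
      qed
      ultimately show ?thesis unfolding K_def by blast
    qed
  qed
  ultimately show ?thesis using stratum unfolding trop_polyhedral_complex_def by blast
qed

end
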